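(* Let $R$ be a semi-local ring (i.e., $R/J(R)$ is semisimple Artinian), where $J(R)$ denotes the Jacobson radical. Then the following are equivalent: (i) $R$ is a GSWNC ring; (ii) one of the following holds: $R$ is a local ring and $J(R)$ is nil; or $J(R)$ is nil and $R/J(R) \cong {\rm M}_2(\mathbb{Z}_3)$; or $J(R)$ is nil and $R/J(R) \cong {\rm M}_2(\mathbb{Z}_2)$; or $J(R)$ is nil and $R/J(R) \cong \mathbb{Z}_3 \times \mathbb{Z}_3$; or $R$ is a strongly weakly nil-clean ring.
   Context: All rings are associative with identity. An element $a$ of a ring $S$ is called strongly weakly nil-clean if there exist an idempotent $e \in S$ and a nilpotent $q \in S$ with $eq = qe$ such that $a = q + e$ or $a = q - e$. A ring is strongly weakly nil-clean if all its elements are strongly weakly nil-clean. A ring $S$ is called GSWNC if every non-invertible element of $S$ is strongly weakly nil-clean. *)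

theory Defs
  imports "HOL-Algebra.Algebra" "HOL-Number_Theory.Residues"
begin

definition idempotent_el :: "('a, 'b) ring_scheme \<Rightarrow> 'a \<Rightarrow> bool" where
  "idempotent_el R e \<longleftrightarrow> e \<in> carrier R \<and> e \<otimes>\<^bsub>R\<^esub> e = e"

definition nilpotent_el :: "('a, 'b) ring_scheme \<Rightarrow> 'a \<Rightarrow> bool" where
  "nilpotent_el R q \<longleftrightarrow> q \<in> carrier R \<and> (\<exists>n::nat. q [^]\<^bsub>R\<^esub> n = \<zero>\<^bsub>R\<^esub>)"

definition swnc_el :: "('a, 'b) ring_scheme \<Rightarrow> 'a \<Rightarrow> bool" where
  "swnc_el R a \<longleftrightarrow> (\<exists>e q. idempotent_el R e \<and> nilpotent_el R q \<and>
      e \<otimes>\<^bsub>R\<^esub> q = q \<otimes>\<^bsub>R\<^esub> e \<and>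
      (a = q \<oplus>\<^bsub>R\<^esub> e \<or> a = q \<ominus>\<^bsub>R\<^esub> e))"

definition swnc_ring :: "('a, 'b) ring_scheme \<Rightarrow> bool" where
  "swnc_ring R \<longleftrightarrow> (\<forall>a \<in> carrier R. swnc_el R a)"

definition GSWNC :: "('a, 'b) ring_scheme \<Rightarrow> bool" where
  "GSWNC R \<longleftrightarrow> (\<forall>a \<in> carrier R. a \<notin> Units R \<longrightarrow> swnc_el R a)"

definition left_ideal :: "('a, 'b) ring_scheme \<Rightarrow> 'a set \<Rightarrow> bool" where
  "left_ideal R I \<longleftrightarrow> additive_subgroup I R \<and>
      (\<forall>r \<in> carrier R. \<forall>x \<in> I. r \<otimes>\<^bsub>R\<^esub> x \<in> I)"

definition maximal_left_ideal :: "('a, 'b) ring_scheme \<Rightarrow> 'a set \<Rightarrow> bool" where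
  "maximal_left_ideal R I \<longleftrightarrow> left_ideal R I \<and> I \<noteq> carrier R \<and>
      (\<forall>K. left_ideal R K \<and> I \<subseteq> K \<longrightarrow> K = I \<or> K = carrier R)"

definition jacobson :: "('a, 'b) ring_scheme \<Rightarrow> 'a set" where
  "jacobson R = carrier R \<inter> \<Inter> {I. maximal_left_ideal R I}"

definition nil_set :: "('a, 'b) ring_scheme \<Rightarrow> 'a set \<Rightarrow> bool" where
  "nil_set R I \<longleftrightarrow> (\<forall>a \<in> I. nilpotent_el R a)"

definition local_ring :: "('a, 'b) ring_scheme \<Rightarrow> bool" where
  "local_ring R \<longleftrightarrow> (\<exists>!I. maximal_left_ideal R I)"

definition left_artinian :: "('a, 'b) ring_scheme \<Rightarrow> bool" where
  "left_artinian R \<longleftrightarrow> (\<forall>f :: nat \<Rightarrow> 'a set.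
      (\<forall>n. left_ideal R (f n) \<and> f (Suc n) \<subseteq> f n) \<longrightarrow> (\<exists>N. \<forall>n\<ge>N. f n = f N))"

definition semisimple_artinian :: "('a, 'b) ring_scheme \<Rightarrow> bool" where
  "semisimple_artinian R \<longleftrightarrow> left_artinian R \<and> jacobson R = {\<zero>\<^bsub>R\<^esub>}"

definition semilocal :: "('a, 'b) ring_scheme \<Rightarrow> bool" where
  "semilocal R \<longleftrightarrow> semisimple_artinian (R Quot (jacobson R))"

definition m2_mult :: "('a, 'b) ring_scheme \<Rightarrow> ('a \<times> 'a \<times> 'a \<times> 'a) \<Rightarrow> ('a \<times> 'a \<times> 'a \<times> 'a) \<Rightarrow> ('a \<times> 'a \<times> 'a \<times> 'a)" where
  "m2_mult A x y = (case x of (a,b,c,d) \<Rightarrow> case y of (a',b',c',d') \<Rightarrow>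
        (a \<otimes>\<^bsub>A\<^esub> a' \<oplus>\<^bsub>A\<^esub> b \<otimes>\<^bsub>A\<^esub> c',
         a \<otimes>\<^bsub>A\<^esub> b' \<oplus>\<^bsub>A\<^esub> b \<otimes>\<^bsub>A\<^esub> d',
         c \<otimes>\<^bsub>A\<^esub> a' \<oplus>\<^bsub>A\<^esub> d \<otimes>\<^bsub>A\<^esub> c',
         c \<otimes>\<^bsub>A\<^esub> b' \<oplus>\<^bsub>A\<^esub> d \<otimes>\<^bsub>A\<^esub> d'))"

definition m2_add :: "('a, 'b) ring_scheme \<Rightarrow> ('a \<times> 'a \<times> 'a \<times> 'a) \<Rightarrow> ('a \<times> 'a \<times> 'a \<times> 'a) \<Rightarrow> ('a \<times> 'a \<times> 'a \<times> 'a)" where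
  "m2_add A x y = (case x of (a,b,c,d) \<Rightarrow> case y of (a',b',c',d') \<Rightarrow>
        (a \<oplus>\<^bsub>A\<^esub> a', b \<oplus>\<^bsub>A\<^esub> b', c \<oplus>\<^bsub>A\<^esub> c', d \<oplus>\<^bsub>A\<^esub> d'))"

(* The ring M_2(A) of 2x2 matrices over A; the matrix ((a,b),(c,d)) is the tuple (a,b,c,d) *)
definition M2 :: "('a, 'b) ring_scheme \<Rightarrow> ('a \<times> 'a \<times> 'a \<times> 'a) ring" where
  "M2 A = \<lparr>carrier = carrier A \<times> carrier A \<times> carrier A \<times> carrier A,
     monoid.mult = m2_mult A,
     one = (\<one>\<^bsub>A\<^esub>, \<zero>\<^bsub>A\<^esub>, \<zero>\<^bsub>A\<^esub>, \<one>\<^bsub>A\<^esub>),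
     ring.zero = (\<zero>\<^bsub>A\<^esub>, \<zero>\<^bsub>A\<^esub>, \<zero>\<^bsub>A\<^esub>, \<zero>\<^bsub>A\<^esub>),
     ring.add = m2_add A\<rparr>"

end

theory Submission
  imports Defs
begin

text \<open>An element \<open>a\<close> is strongly weakly nil-clean iff \<open>a\<^sup>2 - a\<close> or \<open>a\<^sup>2 + a\<close> is nilpotent. Hence the GSWNC
  property passes to \<open>S = R/J\<close>, it forces \<open>J\<close> to be nil, and it lifts back along a nil \<open>J\<close>. The ring
  \<open>S\<close> is von Neumann regular, and this suffices in place of the Wedderburn-Artin theorem.

  If \<open>S\<close> has a nonzero element \<open>x\<close> with \<open>x\<^sup>2 = 0\<close>, regularity completes \<open>x\<close> to a system of \<open>2 \<times> 2\<close> matrix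
  units. The matrix with rows \<open>(0,1)\<close> and \<open>(1,1)\<close> is invertible and so are its sum and difference with the
  identity; were the matrix units not to sum to \<open>1\<close>, it would be a non-unit of \<open>S\<close> that is not strongly
  weakly nil-clean. So \<open>S \<cong> M\<^sub>2(D)\<close>, and \<open>diag(d, 0)\<close> being a non-unit forces \<open>D = {0, 1, -1}\<close>. If \<open>S\<close> is
  reduced with a nontrivial idempotent, every element not of the form \<open>\<plusminus>\<close> idempotent is a difference
  \<open>p - q\<close> of complementary central idempotents, and \<open>S\<close> is then \<open>\<int>\<^sub>3 \<times> \<int>\<^sub>3\<close>.\<close>

section \<open>Idempotent lifting\<close>

text \<open>The polynomial criterion removes the witnesses \<open>e\<close> and \<open>q\<close>,
  which are awkward to transport: a nilpotency condition on a polynomial in \<open>a\<close>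
  survives homomorphisms and lifts along nil ideals. The matrix with rows (0,1), (1,1) is chosen
  because it is integral and \<open>A\<close>, \<open>A - 1\<close>, \<open>A + 1\<close> have
  determinants -1, -1, 1. It therefore serves over any coefficient ring, whatever its characteristic
  and whether or not it commutes. The obstacle is the coefficient ring \<open>D\<close>, known only
  as a corner. A square-zero element or a nontrivial idempotent of \<open>D\<close> would give
  another system of matrix units, too small to sum to 1. So every \<open>d\<close> in
  \<open>D\<close> satisfies \<open>d^2 = d\<close> or \<open>d^2 = -d\<close> and has
  \<open>d^2\<close> equal to 0 or 1. The characteristic is then 2 or 3 because 1 + 1 must be one of
  0, 1, -1. In the reduced case characteristic 2 drops out: if \<open>2p = 0\<close> or
  \<open>2q = 0\<close>, then \<open>p - q\<close> is 1 or -1 and already strongly weakly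
  nil-clean.\<close>

lemma (in ring) nilpotent_mult_commute:
  assumes "nilpotent_el R q" "z \<in> carrier R" "q \<otimes> z = z \<otimes> q"
  shows "nilpotent_el R (q \<otimes> z)"
proof -
  obtain n :: nat where "q \<in> carrier R" "q [^] n = \<zero>"
    using assms(1) unfolding nilpotent_el_def by blast
  then have "(q \<otimes> z) [^] n = \<zero>"
    using assms by (simp add: pow_mult_distrib)
  then show ?thesis
    unfolding nilpotent_el_def using \<open>q \<in> carrier R\<close> assms(2) by blast
qed

lemma (in ring) nilpotent_minus:
  assumes "nilpotent_el R q"
  shows "nilpotent_el R (\<ominus> q)"
proof -
  have q: "q \<in> carrier R" using assms unfolding nilpotent_el_def by blast
  then show ?thesis
    using nilpotent_mult_commute[OF assms, of "\<ominus> \<one>"] by (simp add: r_minus l_minus)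
qed

text \<open>The quotient is the geometric sum in \<open>1 - z\<close>; stating only its existence
  avoids handling that sum.\<close>

lemma (in cring) dvd_one_minus_pow:
  assumes "z \<in> carrier R"
  shows "\<exists>w \<in> carrier R. \<one> \<ominus> (\<one> \<ominus> z) [^] (n::nat) = z \<otimes> w"
proof (induction n)
  case 0
  show ?case using assms by (intro bexI[of _ \<zero>]) (auto simp: r_neg minus_eq)
next
  case (Suc n)
  then obtain w where w: "w \<in> carrier R" "\<one> \<ominus> (\<one> \<ominus> z) [^] n = z \<otimes> w" by blast
  let ?u = "(\<one> \<ominus> z) [^] n"
  have u: "?u \<in> carrier R" using assms by simp
  have "\<one> \<ominus> ?u \<otimes> (\<one> \<ominus> z) = (\<one> \<ominus> ?u) \<oplus> z \<otimes> ?u"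
    using assms u by algebra
  also have "\<dots> = z \<otimes> (w \<oplus> ?u)"
    using assms u w by (simp add: r_distr)
  finally show ?case using w u by auto
qed

text \<open>With \<open>t = (1 - a)\<^sup>n\<close> and \<open>e = (1 - t)\<^sup>n\<close>, both \<open>a\<^sup>n\<close> divides \<open>e\<close> and \<open>t\<close> divides \<open>1 - e\<close>,
  while \<open>a - e\<close> is divisible by both \<open>a\<close> and \<open>1 - a\<close>.\<close>

lemma (in cring) lift_idempotent:
  assumes a: "a \<in> carrier R" and nil: "nilpotent_el R (a \<otimes> a \<ominus> a)"
  shows "\<exists>e. idempotent_el R e \<and> nilpotent_el R (a \<ominus> e)"
proof -
  obtain k :: nat where k: "(a \<otimes> a \<ominus> a) [^] k = \<zero>"
    using nil unfolding nilpotent_el_def by blast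
  \<comment> \<open>The exponent is taken one larger than \<open>k\<close>, so that a factor
    \<open>a\<close> can be split off \<open>a^n\<close> and a factor \<open>b\<close> off
    \<open>b^n\<close>, leaving exponent \<open>k\<close>.\<close>
  define n where "n = Suc k"
  define b where "b = \<one> \<ominus> a"
  have b: "b \<in> carrier R" "a = \<one> \<ominus> b" using a unfolding b_def by (simp, algebra)
  have ab: "a [^] n \<otimes> b [^] n = \<zero>"
  proof -
    have "a [^] n \<otimes> b [^] n = (\<ominus> \<one> \<otimes> (a \<otimes> a \<ominus> a)) [^] n"
    proof -
      have "a \<otimes> b = \<ominus> \<one> \<otimes> (a \<otimes> a \<ominus> a)" unfolding b_def using a by algebra
      then show ?thesis using a b by (metis nat_pow_distrib)
    qed
    also have "\<dots> = (\<ominus> \<one>) [^] n \<otimes> (a \<otimes> a \<ominus> a) [^] n"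
      using a by (simp add: nat_pow_distrib)
    also have "(a \<otimes> a \<ominus> a) [^] n = \<zero>"
      using a k unfolding n_def by simp
    finally show ?thesis by simp
  qed
  obtain w where w: "w \<in> carrier R" "\<one> \<ominus> (\<one> \<ominus> a) [^] n = a \<otimes> w"
    using dvd_one_minus_pow[OF a] by blast
  define t where "t = b [^] n"
  define e where "e = (\<one> \<ominus> t) [^] n"
  have t: "t \<in> carrier R" "e \<in> carrier R" unfolding t_def e_def using b by auto
  obtain v where v: "v \<in> carrier R" "\<one> \<ominus> e = t \<otimes> v"
    using dvd_one_minus_pow[OF t(1)] unfolding e_def by blast
  have "\<one> \<ominus> t = a \<otimes> w" using w unfolding t_def b_def by simp
  then have e1: "e = a [^] n \<otimes> w [^] n" unfolding e_def using a w by (simp add: nat_pow_distrib)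
  have "e \<otimes> (\<one> \<ominus> e) = (a [^] n \<otimes> b [^] n) \<otimes> (w [^] n \<otimes> v)"
    unfolding v(2) unfolding e1 t_def using a b w(1) v(1) by (simp add: m_ac)
  then have ee: "e \<otimes> (\<one> \<ominus> e) = \<zero>" using ab w v by simp
  have "e = e \<otimes> e \<oplus> e \<otimes> (\<one> \<ominus> e)" using t by algebra
  then have id: "idempotent_el R e" unfolding idempotent_el_def using ee t by simp
  define d1 where "d1 = \<one> \<ominus> a [^] k \<otimes> w [^] n"
  have d1: "d1 \<in> carrier R" "a \<ominus> e = a \<otimes> d1"
    unfolding d1_def e1 n_def using a w
    by (simp, simp add: minus_eq r_distr r_minus m_ac)
  define d2 where "d2 = b [^] k \<otimes> v \<ominus> \<one>"
  have d2: "d2 \<in> carrier R" "a \<ominus> e = b \<otimes> d2"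
  proof -
    show "d2 \<in> carrier R" unfolding d2_def using b v by simp
    have "a \<ominus> e = (\<one> \<ominus> e) \<ominus> b" unfolding b_def using a t by algebra
    also have "\<dots> = b \<otimes> d2" unfolding v(2) d2_def t_def n_def using b v
      by (simp add: minus_eq r_distr r_minus m_ac)
    finally show "a \<ominus> e = b \<otimes> d2" .
  qed
  \<comment> \<open>Half of the factors are written as \<open>a d1\<close> and half as
    \<open>b d2\<close>, so that \<open>(ab)^n = 0\<close> appears.\<close>
  have "(a \<ominus> e) [^] (n + n) = (a \<otimes> d1) [^] n \<otimes> (b \<otimes> d2) [^] n"
    using a t d1 d2 by (simp flip: nat_pow_mult)
  also have "\<dots> = (a [^] n \<otimes> b [^] n) \<otimes> (d1 [^] n \<otimes> d2 [^] n)"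
    using a b(1) d1(1) d2(1) by (simp add: nat_pow_distrib m_ac)
  also have "\<dots> = \<zero>" using ab d1 d2 by simp
  finally have "nilpotent_el R (a \<ominus> e)"
    unfolding nilpotent_el_def using a t by blast
  with id show ?thesis by blast
qed

text \<open>The bicommutant of \<open>a\<close> is commutative: since \<open>a\<close> commutes with
  itself, every element of \<open>B\<close> commutes with \<open>a\<close>, so every other element
  of \<open>B\<close> commutes with it. This provides a commutative ring around \<open>a\<close> in
  which idempotent lifting can be carried out.\<close>

lemma (in ring) double_commutant_subcring:
  assumes a: "a \<in> carrier R"
  defines "B \<equiv> {z \<in> carrier R. \<forall>w \<in> carrier R. w \<otimes> a = a \<otimes> w \<longrightarrow> w \<otimes> z = z \<otimes> w}"
  shows "subcring B R" "a \<in> B"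
proof -
  show aB: "a \<in> B" unfolding B_def using a by simp
  have B: "z \<in> B \<longleftrightarrow> z \<in> carrier R \<and> (\<forall>w. w \<in> carrier R \<and> w \<otimes> a = a \<otimes> w \<longrightarrow> w \<otimes> z = z \<otimes> w)" for z
    unfolding B_def by blast
  have "subring B R"
  proof (rule subringI)
    show "B \<subseteq> carrier R" "\<one> \<in> B" using B by auto
    show "\<ominus> h \<in> B" if "h \<in> B" for h
      using that l_minus r_minus unfolding B by (metis a_inv_closed)
    fix h1 h2 assume h: "h1 \<in> B" "h2 \<in> B"
    then have c: "h1 \<in> carrier R" "h2 \<in> carrier R" using B by blast+
    have "w \<otimes> (h1 \<otimes> h2) = h1 \<otimes> h2 \<otimes> w" "w \<otimes> (h1 \<oplus> h2) = (h1 \<oplus> h2) \<otimes> w"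
      if w: "w \<in> carrier R" "w \<otimes> a = a \<otimes> w" for w
    proof -
      have h': "w \<otimes> h1 = h1 \<otimes> w" "w \<otimes> h2 = h2 \<otimes> w" using h w B by blast+
      have "w \<otimes> (h1 \<otimes> h2) = (w \<otimes> h1) \<otimes> h2" using c w(1) by (simp add: m_assoc)
      also have "\<dots> = h1 \<otimes> (w \<otimes> h2)" using c w(1) by (simp add: h'(1) m_assoc)
      also have "\<dots> = h1 \<otimes> h2 \<otimes> w" using c w(1) by (simp add: h'(2) m_assoc)
      finally show "w \<otimes> (h1 \<otimes> h2) = h1 \<otimes> h2 \<otimes> w" .
      show "w \<otimes> (h1 \<oplus> h2) = (h1 \<oplus> h2) \<otimes> w"
        using c w(1) h' by (simp add: l_distr r_distr)
    qed
    then show "h1 \<otimes> h2 \<in> B" "h1 \<oplus> h2 \<in> B" using c unfolding B by blast+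
  qed
  then show "subcring B R"
  proof (rule subcringI)
    fix h1 h2 assume h: "h1 \<in> B" "h2 \<in> B"
    have "a \<otimes> h1 = h1 \<otimes> a" using h(1) a unfolding B by blast
    then show "h1 \<otimes> h2 = h2 \<otimes> h1" using h unfolding B by metis
  qed
qed

lemma (in ring) a_minus_subring:
  assumes "subring H R" "x \<in> H" "y \<in> H"
  shows "x \<ominus>\<^bsub>R\<lparr>carrier := H\<rparr>\<^esub> y = x \<ominus> y"
proof -
  interpret H: ring "R\<lparr>carrier := H\<rparr>" using subring_is_ring[OF assms(1)] .
  have "H \<subseteq> carrier R" using subringE(1)[OF assms(1)] .
  moreover have "\<ominus>\<^bsub>R\<lparr>carrier := H\<rparr>\<^esub> y = \<ominus> y"
    using H.l_neg[of y] H.a_inv_closed[of y] assms calculation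
    by (intro minus_equality[symmetric]) auto
  ultimately show ?thesis by (simp add: a_minus_def)
qed

lemma (in ring) nilpotent_el_subring:
  assumes "subring H R" "x \<in> H"
  shows "nilpotent_el (R\<lparr>carrier := H\<rparr>) x \<longleftrightarrow> nilpotent_el R x"
  using assms subringE(1)[OF assms(1)] unfolding nilpotent_el_def
  by (auto simp: nat_pow_consistent[symmetric])

text \<open>Lifting inside the bicommutant of \<open>a\<close> makes the idempotent commute with the
  nilpotent remainder automatically.\<close>

lemma (in ring) strongly_nil_clean_of_nilpotent:
  assumes a: "a \<in> carrier R" and nil: "nilpotent_el R (a \<otimes> a \<ominus> a)"
  shows "\<exists>e q. idempotent_el R e \<and> nilpotent_el R q \<and> e \<otimes> q = q \<otimes> e \<and> a = q \<oplus> e"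
proof -
  define B where "B = {z \<in> carrier R. \<forall>w \<in> carrier R. w \<otimes> a = a \<otimes> w \<longrightarrow> w \<otimes> z = z \<otimes> w}"
  have B: "subcring B R" "a \<in> B" using double_commutant_subcring[OF a] unfolding B_def by auto
  have BR: "B \<subseteq> carrier R" unfolding B_def by blast
  have sB: "subring B R" using B(1) subcring.axioms(1) by blast
  interpret B: cring "R\<lparr>carrier := B\<rparr>" using B(1) subcring_iff[OF BR] by blast
  have aa: "a \<otimes> a \<in> B" using B.m_closed[of a a] B by simp
  then have "a \<otimes> a \<ominus> a \<in> B"
    using B.minus_closed[of "a \<otimes> a" a] B a_minus_subring[OF sB] by simp
  then have "nilpotent_el (R\<lparr>carrier := B\<rparr>) (a \<otimes>\<^bsub>R\<lparr>carrier := B\<rparr>\<^esub> a \<ominus>\<^bsub>R\<lparr>carrier := B\<rparr>\<^esub> a)"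
    using nil B aa by (simp add: nilpotent_el_subring[OF sB] a_minus_subring[OF sB])
  then obtain e where e: "idempotent_el (R\<lparr>carrier := B\<rparr>) e"
      "nilpotent_el (R\<lparr>carrier := B\<rparr>) (a \<ominus>\<^bsub>R\<lparr>carrier := B\<rparr>\<^esub> e)"
    using B.lift_idempotent B by auto
  have eB: "e \<in> B" using e unfolding idempotent_el_def by simp
  have q: "a \<ominus> e \<in> B" using B.minus_closed[of a e] B eB a_minus_subring[OF sB] by simp
  have "idempotent_el R e" using e eB BR unfolding idempotent_el_def by auto
  moreover have "nilpotent_el R (a \<ominus> e)"
    using e eB B q by (simp add: nilpotent_el_subring[OF sB] a_minus_subring[OF sB])
  moreover have "e \<otimes> (a \<ominus> e) = (a \<ominus> e) \<otimes> e"
    using subcringE(8)[OF B(1)] eB q by blast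
  moreover have "a = (a \<ominus> e) \<oplus> e" using a eB BR by (simp add: minus_eq a_assoc l_neg subset_iff)
  ultimately show ?thesis by blast
qed


text \<open>If \<open>a = q + e\<close>, then \<open>a^2 - a = q(q + 2e - 1)\<close>; if
  \<open>a = q - e\<close>, then \<open>a^2 + a = q(q - 2e + 1)\<close>. In both, the cofactor
  commutes with \<open>q\<close>. Conversely the idempotent is lifted from \<open>a\<close> in one
  case and from \<open>-a\<close> in the other.\<close>

lemma (in ring) swnc_el_iff:
  assumes a: "a \<in> carrier R"
  shows "swnc_el R a \<longleftrightarrow> nilpotent_el R (a \<otimes> a \<ominus> a) \<or> nilpotent_el R (a \<otimes> a \<oplus> a)"
proof
  assume "swnc_el R a"
  then obtain e q where eq: "idempotent_el R e" "nilpotent_el R q"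
      "e \<otimes> q = q \<otimes> e" "a = q \<oplus> e \<or> a = q \<ominus> e"
    unfolding swnc_el_def by blast
  have c: "e \<in> carrier R" "q \<in> carrier R" "e \<otimes> e = e"
    using eq unfolding idempotent_el_def nilpotent_el_def by auto
  from eq(4) show "nilpotent_el R (a \<otimes> a \<ominus> a) \<or> nilpotent_el R (a \<otimes> a \<oplus> a)"
  proof
    assume A: "a = q \<oplus> e"
    have "a \<otimes> a \<ominus> a = q \<otimes> (q \<oplus> e \<oplus> e \<ominus> \<one>)"
      unfolding A using c eq(3) by (simp add: ring_simprules)
    moreover have "nilpotent_el R (q \<otimes> (q \<oplus> e \<oplus> e \<ominus> \<one>))"
      using c eq(3) by (intro nilpotent_mult_commute[OF eq(2)]) (auto simp: ring_simprules)
    ultimately show ?thesis by simp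
  next
    assume A: "a = q \<ominus> e"
    have "a \<otimes> a \<oplus> a = (q \<otimes> q \<ominus> q \<otimes> e \<ominus> e \<otimes> q \<oplus> e \<otimes> e) \<oplus> (q \<ominus> e)"
      unfolding A using c(1,2) by algebra
    also have "\<dots> = q \<otimes> q \<ominus> q \<otimes> e \<ominus> q \<otimes> e \<oplus> q"
      unfolding eq(3) c(3) using c(1,2) by algebra
    also have "\<dots> = q \<otimes> (q \<ominus> e \<ominus> e \<oplus> \<one>)"
      using c(1,2) by (simp add: minus_eq r_distr r_minus)
    finally have "a \<otimes> a \<oplus> a = q \<otimes> (q \<ominus> e \<ominus> e \<oplus> \<one>)" .
    moreover have "nilpotent_el R (q \<otimes> (q \<ominus> e \<ominus> e \<oplus> \<one>))"
      using c eq(3) by (intro nilpotent_mult_commute[OF eq(2)]) (auto simp: ring_simprules)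
    ultimately show ?thesis by simp
  qed
next
  assume "nilpotent_el R (a \<otimes> a \<ominus> a) \<or> nilpotent_el R (a \<otimes> a \<oplus> a)"
  then show "swnc_el R a"
  proof
    assume "nilpotent_el R (a \<otimes> a \<ominus> a)"
    from strongly_nil_clean_of_nilpotent[OF a this] show ?thesis
      unfolding swnc_el_def by blast
  next
    assume "nilpotent_el R (a \<otimes> a \<oplus> a)"
    then have "nilpotent_el R ((\<ominus> a) \<otimes> (\<ominus> a) \<ominus> (\<ominus> a))"
      using a by (simp add: l_minus r_minus minus_eq)
    from strongly_nil_clean_of_nilpotent[OF _ this] obtain e q
      where eq: "idempotent_el R e" "nilpotent_el R q" "e \<otimes> q = q \<otimes> e" "\<ominus> a = q \<oplus> e"
      using a by auto
    have c: "e \<in> carrier R" "q \<in> carrier R"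
      using eq unfolding idempotent_el_def nilpotent_el_def by auto
    have "a = \<ominus> (q \<oplus> e)" using eq(4) a by (metis minus_minus)
    also have "\<dots> = \<ominus> q \<ominus> e" using c by algebra
    finally have "a = \<ominus> q \<ominus> e" .
    moreover have "e \<otimes> (\<ominus> q) = (\<ominus> q) \<otimes> e" using eq c by (simp add: l_minus r_minus)
    ultimately show ?thesis
      unfolding swnc_el_def using eq nilpotent_minus[OF eq(2)] by blast
  qed
qed

section \<open>The Jacobson radical\<close>

lemma (in ring) left_ideal_iff:
  "left_ideal R I \<longleftrightarrow> I \<subseteq> carrier R \<and> \<zero> \<in> I \<and> (\<forall>x \<in> I. \<forall>y \<in> I. x \<oplus> y \<in> I)
     \<and> (\<forall>r \<in> carrier R. \<forall>x \<in> I. r \<otimes> x \<in> I)"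
proof
  assume L: "left_ideal R I"
  then interpret additive_subgroup I R unfolding left_ideal_def by blast
  show "I \<subseteq> carrier R \<and> \<zero> \<in> I \<and> (\<forall>x \<in> I. \<forall>y \<in> I. x \<oplus> y \<in> I)
     \<and> (\<forall>r \<in> carrier R. \<forall>x \<in> I. r \<otimes> x \<in> I)"
    using L a_subset unfolding left_ideal_def by auto
next
  assume L: "I \<subseteq> carrier R \<and> \<zero> \<in> I \<and> (\<forall>x \<in> I. \<forall>y \<in> I. x \<oplus> y \<in> I)
     \<and> (\<forall>r \<in> carrier R. \<forall>x \<in> I. r \<otimes> x \<in> I)"
  have "\<ominus> x \<in> I" if "x \<in> I" for x
  proof -
    have "\<ominus> x = \<ominus> \<one> \<otimes> x" using L that by (simp add: l_minus subset_iff)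
    also have "\<dots> \<in> I" using L that by blast
    finally show ?thesis .
  qed
  then have "subgroup I (add_monoid R)"
    using L by (intro add.subgroupI) auto
  then show "left_ideal R I"
    using L unfolding left_ideal_def by (auto intro: additive_subgroupI)
qed

lemma (in ring)
  assumes "left_ideal R I"
  shows left_ideal_carrier: "x \<in> I \<Longrightarrow> x \<in> carrier R"
    and left_ideal_zero: "\<zero> \<in> I"
    and left_ideal_add: "x \<in> I \<Longrightarrow> y \<in> I \<Longrightarrow> x \<oplus> y \<in> I"
    and left_ideal_mult: "r \<in> carrier R \<Longrightarrow> x \<in> I \<Longrightarrow> r \<otimes> x \<in> I"
    and left_ideal_uminus: "x \<in> I \<Longrightarrow> \<ominus> x \<in> I"
    and left_ideal_minus: "x \<in> I \<Longrightarrow> y \<in> I \<Longrightarrow> x \<ominus> y \<in> I"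
    and left_ideal_eq_carrier: "\<one> \<in> I \<Longrightarrow> I = carrier R"
proof -
  note L = assms[unfolded left_ideal_iff]
  show "x \<in> I \<Longrightarrow> x \<in> carrier R" "\<zero> \<in> I" "x \<in> I \<Longrightarrow> y \<in> I \<Longrightarrow> x \<oplus> y \<in> I"
    "r \<in> carrier R \<Longrightarrow> x \<in> I \<Longrightarrow> r \<otimes> x \<in> I" for x y r
    using L by auto
  show um: "\<ominus> x \<in> I" if "x \<in> I" for x
  proof -
    have "\<ominus> x = \<ominus> \<one> \<otimes> x" using L that by (simp add: l_minus subset_iff)
    also have "\<dots> \<in> I" using L that by blast
    finally show ?thesis .
  qed
  show "x \<in> I \<Longrightarrow> y \<in> I \<Longrightarrow> x \<ominus> y \<in> I" for x y
    using L um by (simp add: minus_eq)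
  show "I = carrier R" if "\<one> \<in> I"
  proof -
    have "r \<in> I" if "r \<in> carrier R" for r
      using L \<open>\<one> \<in> I\<close> that r_one by metis
    then show ?thesis using L by blast
  qed
qed

lemma (in ring) left_ideal_principal:
  assumes "a \<in> carrier R"
  shows "left_ideal R ((\<lambda>r. r \<otimes> a) ` carrier R)"
  unfolding left_ideal_iff
proof (intro conjI ballI)
  show "(\<lambda>r. r \<otimes> a) ` carrier R \<subseteq> carrier R" using assms by auto
  show "\<zero> \<in> (\<lambda>r. r \<otimes> a) ` carrier R" using assms by (intro image_eqI[of _ _ \<zero>]) auto
next
  fix x y assume "x \<in> (\<lambda>r. r \<otimes> a) ` carrier R" "y \<in> (\<lambda>r. r \<otimes> a) ` carrier R"
  then obtain r s where "r \<in> carrier R" "s \<in> carrier R" "x = r \<otimes> a" "y = s \<otimes> a" by blast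
  then show "x \<oplus> y \<in> (\<lambda>r. r \<otimes> a) ` carrier R"
    using assms by (intro image_eqI[of _ _ "r \<oplus> s"]) (auto simp: l_distr)
next
  fix t x assume "t \<in> carrier R" "x \<in> (\<lambda>r. r \<otimes> a) ` carrier R"
  then obtain r where "r \<in> carrier R" "x = r \<otimes> a" by blast
  then show "t \<otimes> x \<in> (\<lambda>r. r \<otimes> a) ` carrier R"
    using assms \<open>t \<in> carrier R\<close> by (intro image_eqI[of _ _ "t \<otimes> r"]) (auto simp: m_assoc)
qed

lemma (in ring) left_ideal_set_add:
  assumes A: "left_ideal R A" and B: "left_ideal R B"
  shows "left_ideal R (set_add R A B)"
proof -
  have "additive_subgroup (set_add R A B) R"
    using A B add_additive_subgroups unfolding left_ideal_def by blast
  moreover have "r \<otimes> x \<in> set_add R A B" if r: "r \<in> carrier R" and x: "x \<in> set_add R A B" for r x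
  proof -
    obtain a b where ab: "a \<in> A" "b \<in> B" "x = a \<oplus> b"
      using x unfolding set_add_def' by blast
    then have "r \<otimes> x = r \<otimes> a \<oplus> r \<otimes> b"
      using left_ideal_carrier[OF A] left_ideal_carrier[OF B] r by (simp add: r_distr)
    then show ?thesis
      using left_ideal_mult[OF A r ab(1)] left_ideal_mult[OF B r ab(2)]
      unfolding set_add_def' by blast
  qed
  ultimately show ?thesis unfolding left_ideal_def by blast
qed

lemma (in ring) exists_maximal_left_ideal:
  assumes I: "left_ideal R I" "\<one> \<notin> I"
  shows "\<exists>M. maximal_left_ideal R M \<and> I \<subseteq> M"
proof -
  define F where "F = {K. left_ideal R K \<and> I \<subseteq> K \<and> \<one> \<notin> K}"
  have "\<exists>M \<in> F. \<forall>L \<in> F. M \<subseteq> L \<longrightarrow> L = M"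
  proof (rule subset_Zorn_nonempty)
    show "F \<noteq> {}" using I unfolding F_def by blast
    fix C assume C: "C \<noteq> {}" "subset.chain F C"
    then have sub: "C \<subseteq> F" and tot: "\<And>K L. K \<in> C \<Longrightarrow> L \<in> C \<Longrightarrow> K \<subseteq> L \<or> L \<subseteq> K"
      by (auto simp: subset_chain_def)
    have CL: "left_ideal R K" if "K \<in> C" for K using sub that unfolding F_def by blast
    have "left_ideal R (\<Union> C)"
      unfolding left_ideal_iff
    proof (intro conjI ballI)
      show "\<Union> C \<subseteq> carrier R" using CL left_ideal_carrier by blast
      show "\<zero> \<in> \<Union> C" using CL left_ideal_zero C(1) by blast
      show "r \<otimes> x \<in> \<Union> C" if "r \<in> carrier R" "x \<in> \<Union> C" for r x
        using CL left_ideal_mult that by blast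
      fix x y assume "x \<in> \<Union> C" "y \<in> \<Union> C"
      then obtain K L where "K \<in> C" "L \<in> C" "x \<in> K" "y \<in> L" by blast
      then obtain Z where "Z \<in> C" "x \<in> Z" "y \<in> Z" using tot[of K L] by blast
      then show "x \<oplus> y \<in> \<Union> C" using CL left_ideal_add by blast
    qed
    then show "\<Union> C \<in> F" using sub C(1) unfolding F_def by auto
  qed
  then obtain M where M: "M \<in> F" "\<And>K. K \<in> F \<Longrightarrow> M \<subseteq> K \<Longrightarrow> K = M" by blast
  have "K = M \<or> K = carrier R" if "left_ideal R K" "M \<subseteq> K" for K
    using M that left_ideal_eq_carrier[OF that(1)] unfolding F_def by auto
  then have "maximal_left_ideal R M"
    using M(1) unfolding maximal_left_ideal_def F_def by blast
  then show ?thesis using M(1) unfolding F_def by blast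
qed

text \<open>The module \<open>R/M\<close> is simple, hence generated by the class of
  \<open>z\<close>. The elementwise form spares the quotient module.\<close>

lemma (in ring) maximal_left_ideal_comaximal:
  assumes M: "maximal_left_ideal R M" and z: "z \<in> carrier R" "z \<notin> M" and r: "r \<in> carrier R"
  shows "\<exists>s \<in> carrier R. r \<ominus> s \<otimes> z \<in> M"
proof -
  let ?K = "set_add R M ((\<lambda>r. r \<otimes> z) ` carrier R)"
  have LM: "left_ideal R M" using M unfolding maximal_left_ideal_def by blast
  have K: "left_ideal R ?K" using left_ideal_set_add[OF LM left_ideal_principal[OF z(1)]] .
  have "M \<subseteq> ?K"
  proof
    fix m assume m: "m \<in> M"
    then have "m = m \<oplus> \<zero> \<otimes> z" using z left_ideal_carrier[OF LM] by simp
    then show "m \<in> ?K" using m unfolding set_add_def' by blast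
  qed
  moreover have "z \<in> ?K"
  proof -
    have "z = \<zero> \<oplus> \<one> \<otimes> z" using z by simp
    then show ?thesis using left_ideal_zero[OF LM] unfolding set_add_def' by blast
  qed
  ultimately have "?K = carrier R" using M K z(2) unfolding maximal_left_ideal_def by blast
  then obtain m s where ms: "m \<in> M" "s \<in> carrier R" "r = m \<oplus> s \<otimes> z"
    using r unfolding set_add_def' by blast
  moreover have "r \<ominus> s \<otimes> z = m"
    using ms z left_ideal_carrier[OF LM ms(1)] by (simp add: minus_eq a_assoc r_neg)
  ultimately show ?thesis by (intro bexI[of _ s]) auto
qed

lemma (in ring) jacobson_iff:
  "x \<in> jacobson R \<longleftrightarrow> x \<in> carrier R \<and> (\<forall>M. maximal_left_ideal R M \<longrightarrow> x \<in> M)"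
  unfolding jacobson_def by blast

lemma (in ring) left_ideal_jacobson: "left_ideal R (jacobson R)"
  using left_ideal_zero left_ideal_add left_ideal_mult
  unfolding left_ideal_iff[of "jacobson R"] by (auto simp: jacobson_iff maximal_left_ideal_def)

text \<open>If \<open>M\<close> is a maximal left ideal and \<open>r \<notin> M\<close>, then \<open>{y. y r \<in> M}\<close> is again a maximal
  left ideal.\<close>

lemma (in ring) jacobson_mult_right:
  assumes x: "x \<in> jacobson R" and r: "r \<in> carrier R"
  shows "x \<otimes> r \<in> jacobson R"
  unfolding jacobson_iff
proof (intro conjI allI impI)
  have xc: "x \<in> carrier R" using x jacobson_iff by blast
  then show "x \<otimes> r \<in> carrier R" using r by simp
  fix M assume M: "maximal_left_ideal R M"
  then have LM: "left_ideal R M" unfolding maximal_left_ideal_def by blast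
  show "x \<otimes> r \<in> M"
  proof (cases "r \<in> M")
    case True
    then show ?thesis using left_ideal_mult[OF LM xc] by blast
  next
    case False
    define N where "N = {y \<in> carrier R. y \<otimes> r \<in> M}"
    have LN: "left_ideal R N"
      unfolding left_ideal_iff N_def
      using r left_ideal_zero[OF LM] left_ideal_add[OF LM] left_ideal_mult[OF LM]
      by (auto simp: l_distr m_assoc)
    have "K = N \<or> K = carrier R" if K: "left_ideal R K" "N \<subseteq> K" for K
    proof (rule disjCI)
      assume "K \<noteq> carrier R"
      have "k \<otimes> r \<in> M" if k: "k \<in> K" for k
      proof (rule ccontr)
        \<comment> \<open>Otherwise \<open>r\<close> agrees with \<open>s k r\<close> modulo
          \<open>M\<close>, so \<open>1 - s k\<close> lies in \<open>N\<close> and hence in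
          \<open>K\<close>; adding \<open>s k\<close> puts 1 into \<open>K\<close>.\<close>
        assume "k \<otimes> r \<notin> M"
        have kc: "k \<in> carrier R" using left_ideal_carrier[OF K(1) k] .
        then obtain s where s: "s \<in> carrier R" "r \<ominus> s \<otimes> (k \<otimes> r) \<in> M"
          using maximal_left_ideal_comaximal[OF M _ \<open>k \<otimes> r \<notin> M\<close> r] r by blast
        have "(\<one> \<ominus> s \<otimes> k) \<otimes> r = r \<ominus> s \<otimes> (k \<otimes> r)"
          using s r kc by (simp add: minus_eq l_distr l_minus m_assoc)
        then have "\<one> \<ominus> s \<otimes> k \<in> K" using K(2) s kc unfolding N_def by auto
        then have "(\<one> \<ominus> s \<otimes> k) \<oplus> s \<otimes> k \<in> K"
          using left_ideal_add[OF K(1)] left_ideal_mult[OF K(1) s(1) k] by blast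
        moreover have "(\<one> \<ominus> s \<otimes> k) \<oplus> s \<otimes> k = \<one>"
          using s kc by (simp add: minus_eq a_assoc l_neg)
        ultimately show False using left_ideal_eq_carrier[OF K(1)] \<open>K \<noteq> carrier R\<close> by simp
      qed
      then show "K = N" using K left_ideal_carrier[OF K(1)] unfolding N_def by blast
    qed
    moreover have "\<one> \<notin> N" using False r unfolding N_def by simp
    ultimately have "maximal_left_ideal R N"
      using LN unfolding maximal_left_ideal_def by blast
    then show ?thesis using x unfolding jacobson_iff N_def by blast
  qed
qed

lemma (in ring) ideal_jacobson: "ideal (jacobson R) R"
proof (rule idealI)
  show "subgroup (jacobson R) (add_monoid R)"
    using left_ideal_jacobson unfolding left_ideal_def additive_subgroup_def by blast
qed (auto intro: jacobson_mult_right left_ideal_mult[OF left_ideal_jacobson] ring_axioms)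

section \<open>Units modulo the radical\<close>

lemma (in ring) one_add_jacobson_left_inverse:
  assumes j: "j \<in> jacobson R"
  shows "\<exists>u \<in> carrier R. u \<otimes> (\<one> \<oplus> j) = \<one>"
proof (rule ccontr)
  assume no: "\<not> ?thesis"
  have jc: "j \<in> carrier R" using j jacobson_iff by blast
  let ?I = "(\<lambda>r. r \<otimes> (\<one> \<oplus> j)) ` carrier R"
  have "\<one> \<notin> ?I" using no by auto
  then obtain M where M: "maximal_left_ideal R M" "?I \<subseteq> M"
    using exists_maximal_left_ideal[OF left_ideal_principal] jc by (meson a_closed one_closed)
  then have LM: "left_ideal R M" unfolding maximal_left_ideal_def by blast
  have "\<one> \<otimes> (\<one> \<oplus> j) \<in> M" using M(2) by blast
  then have "\<one> \<oplus> j \<ominus> j \<in> M"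
    using left_ideal_minus[OF LM] j M(1) jc jacobson_iff by simp
  then have "\<one> \<in> M" using jc by (simp add: minus_eq a_assoc r_neg)
  then show False using M(1) left_ideal_eq_carrier[OF LM] unfolding maximal_left_ideal_def by blast
qed

text \<open>A left inverse \<open>u\<close> of \<open>1 + j\<close> equals \<open>1 - u j\<close>,
  so it is again of the form 1 plus a radical element and has a left inverse itself. An element with
  inverses on both sides is a unit.\<close>

lemma (in ring) one_add_jacobson_Units:
  assumes j: "j \<in> jacobson R"
  shows "\<one> \<oplus> j \<in> Units R"
proof -
  have jc: "j \<in> carrier R" using j jacobson_iff by blast
  obtain u where u: "u \<in> carrier R" "u \<otimes> (\<one> \<oplus> j) = \<one>"
    using one_add_jacobson_left_inverse[OF j] by blast
  have "u \<oplus> u \<otimes> j = \<one>" using u jc by (simp add: r_distr)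
  moreover have "u = (u \<oplus> u \<otimes> j) \<oplus> (\<ominus> u) \<otimes> j" using u jc by algebra
  ultimately have "u = \<one> \<oplus> (\<ominus> u) \<otimes> j" by simp
  moreover have "(\<ominus> u) \<otimes> j \<in> jacobson R"
    using left_ideal_mult[OF left_ideal_jacobson] j u by simp
  ultimately obtain v where v: "v \<in> carrier R" "v \<otimes> u = \<one>"
    using one_add_jacobson_left_inverse by metis
  have "v = v \<otimes> (u \<otimes> (\<one> \<oplus> j))" using u v by simp
  also have "\<dots> = (v \<otimes> u) \<otimes> (\<one> \<oplus> j)" using u(1) v(1) jc by (simp add: m_assoc)
  also have "\<dots> = \<one> \<oplus> j" using v(2) jc by simp
  finally show ?thesis using u v jc unfolding Units_def by auto
qed

lemma (in ring) Units_of_mult_Units: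
  assumes "a \<in> carrier R" "b \<in> carrier R" "a \<otimes> b \<in> Units R" "b \<otimes> a \<in> Units R"
  shows "a \<in> Units R"
proof -
  let ?u = "inv (b \<otimes> a) \<otimes> b" and ?v = "b \<otimes> inv (a \<otimes> b)"
  have uv: "?u \<in> carrier R" "?v \<in> carrier R" using assms by auto
  have 1: "?u \<otimes> a = \<one>" using assms by (simp add: m_assoc)
  have 2: "a \<otimes> ?v = \<one>" using assms by (simp flip: m_assoc)
  have "?u = ?u \<otimes> (a \<otimes> ?v)" using 2 uv by simp
  also have "\<dots> = ?v" using 1 uv assms(1) by (simp flip: m_assoc)
  finally have "a \<otimes> ?u = \<one>" using 2 by simp
  then show ?thesis unfolding Units_def using 1 uv(1) assms(1) by blast
qed

text \<open>If \<open>K\<close> is minimal among the left ideals with \<open>R a + K = R\<close>, then \<open>R a \<inter> K = 0\<close>: a maximal left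
  ideal missing a nonzero element of the intersection would cut \<open>K\<close> down further. Then the
  decomposition \<open>1 = y a + k\<close> gives \<open>a = a y a\<close>.\<close>

lemma (in ring) semisimple_artinian_regular:
  assumes S: "semisimple_artinian R" and a: "a \<in> carrier R"
  shows "\<exists>y \<in> carrier R. a \<otimes> y \<otimes> a = a"
proof -
  define P where "P K \<longleftrightarrow> left_ideal R K \<and> (\<exists>y \<in> carrier R. \<exists>k \<in> K. \<one> = y \<otimes> a \<oplus> k)" for K
  have "\<exists>K. P K \<and> (\<forall>K'. P K' \<and> K' \<subseteq> K \<longrightarrow> K' = K)"
  proof (rule ccontr)
    assume no: "\<not> ?thesis"
    have "P (carrier R)"
      unfolding P_def left_ideal_iff using a
      by (intro conjI bexI[of _ \<zero>] bexI[of _ \<one>]) auto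
    then have "\<exists>f. \<forall>n. P (f n) \<and> f (Suc n) \<subset> f n"
      using no by (intro dependent_nat_choice) blast+
    then obtain f where f: "\<And>n. P (f n)" "\<And>n. f (Suc n) \<subset> f n" by blast
    then have "\<forall>n. left_ideal R (f n) \<and> f (Suc n) \<subseteq> f n" unfolding P_def by blast
    then obtain N where "\<forall>n \<ge> N. f n = f N"
      using S unfolding semisimple_artinian_def left_artinian_def by blast
    then have "f (Suc N) = f N" using le_SucI[OF order_refl] by blast
    then show False using f(2) by blast
  qed
  then obtain K where K: "P K" "\<And>K'. P K' \<Longrightarrow> K' \<subseteq> K \<Longrightarrow> K' = K" by blast
  then obtain y k where LK: "left_ideal R K" and yk: "y \<in> carrier R" "k \<in> K" "\<one> = y \<otimes> a \<oplus> k"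
    unfolding P_def by blast
  have kc: "k \<in> carrier R" using left_ideal_carrier[OF LK yk(2)] .
  have int: "z = \<zero>" if z: "z \<in> K" "z = r \<otimes> a" "r \<in> carrier R" for z r
  proof (rule ccontr)
    assume "z \<noteq> \<zero>"
    then have "z \<notin> jacobson R" using S unfolding semisimple_artinian_def by simp
    moreover have zc: "z \<in> carrier R" using z a by simp
    ultimately obtain M where M: "maximal_left_ideal R M" "z \<notin> M" unfolding jacobson_iff by blast
    have LM: "left_ideal R M" using M(1) unfolding maximal_left_ideal_def by blast
    obtain s where s: "s \<in> carrier R" "k \<ominus> s \<otimes> z \<in> M"
      using maximal_left_ideal_comaximal[OF M(1) zc M(2) kc] by blast
    have "left_ideal R (K \<inter> M)"
      using LK LM unfolding left_ideal_iff by blast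
    moreover have "k \<ominus> s \<otimes> z \<in> K"
      using left_ideal_minus[OF LK yk(2)] left_ideal_mult[OF LK s(1) z(1)] by blast
    moreover have "\<one> = (y \<oplus> s \<otimes> r) \<otimes> a \<oplus> (k \<ominus> s \<otimes> z)"
    proof -
      have "(y \<oplus> s \<otimes> r) \<otimes> a \<oplus> (k \<ominus> s \<otimes> z) = y \<otimes> a \<oplus> k"
        using yk(1) kc s(1) z(3) a unfolding z(2) by algebra
      then show ?thesis using yk(3) by simp
    qed
    ultimately have "P (K \<inter> M)"
      unfolding P_def using s yk(1) z(3) by (metis IntI a_closed m_closed)
    then have "K \<inter> M = K" using K(2) by blast
    then show False using z(1) M(2) by blast
  qed
  have "a = a \<otimes> (y \<otimes> a \<oplus> k)" using a yk(3)[symmetric] by simp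
  then have ak: "a \<ominus> a \<otimes> y \<otimes> a = a \<otimes> k"
  proof -
    have "a \<otimes> (y \<otimes> a \<oplus> k) \<ominus> a \<otimes> y \<otimes> a = a \<otimes> k" using a yk(1) kc by algebra
    then show ?thesis using \<open>a = a \<otimes> (y \<otimes> a \<oplus> k)\<close> by simp
  qed
  \<comment> \<open>The element \<open>a k = a - a y a\<close> lies in \<open>K\<close>, a left
    ideal, and visibly in \<open>R a\<close>; by \<open>int\<close> it vanishes.\<close>
  have "a \<otimes> k = (\<one> \<ominus> a \<otimes> y) \<otimes> a"
    unfolding ak[symmetric] using a yk(1) by algebra
  then have "a \<otimes> k = \<zero>"
    using int[of "a \<otimes> k" "\<one> \<ominus> a \<otimes> y"] left_ideal_mult[OF LK a yk(2)] a yk(1) by simp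
  then have "a = a \<otimes> y \<otimes> a" using ak a yk(1) by simp
  then show ?thesis using yk(1) by metis
qed

section \<open>Reduced rings\<close>

context ring
begin

text \<open>If \<open>z^(k+2) = 0\<close>, then \<open>z^(k+1)\<close> squares to 0, so the exponent
  can be lowered. The set \<open>A\<close> need not contain 1, which lets the lemma serve both a
  reduced ring and a corner \<open>e R e\<close>; hence only positive powers are claimed to lie in
  \<open>A\<close>.\<close>

lemma nilpotent_eq_zero:
  assumes A: "A \<subseteq> carrier R" "\<And>a b. a \<in> A \<Longrightarrow> b \<in> A \<Longrightarrow> a \<otimes> b \<in> A"
    and red: "\<And>a. a \<in> A \<Longrightarrow> a \<otimes> a = \<zero> \<Longrightarrow> a = \<zero>"
    and z: "z \<in> A" "nilpotent_el R z"
  shows "z = \<zero>"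
proof -
  have zc: "z \<in> carrier R" using A z by blast
  have pow: "z [^] Suc k \<in> A" for k
    by (induction k) (use A z zc in auto)
  have "z [^] n = \<zero> \<Longrightarrow> z = \<zero>" for n :: nat
  proof (induction n rule: less_induct)
    case (less n)
    consider "n = 0" | "n = 1" | k where "n = Suc (Suc k)"
      by (metis One_nat_def not0_implies_Suc)
    then show ?case
    proof cases
      case 1
      then have "\<one> = \<zero>" using less.prems by simp
      then show ?thesis using zc one_zeroD by blast
    next
      case 2
      then show ?thesis using less.prems zc by simp
    next
      case 3
      have "z [^] Suc k \<otimes> z [^] Suc k = z [^] n \<otimes> z [^] k"
        unfolding 3 using zc by (simp only: nat_pow_mult) simp
      then have "z [^] Suc k = \<zero>" using red[OF pow] less.prems zc by simp
      then show ?thesis using less.IH[of "Suc k"] 3 by simp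
    qed
  qed
  then show ?thesis using z unfolding nilpotent_el_def by blast
qed

text \<open>The standard source of non-units below: an element of a proper corner is killed by the
  complementary idempotent.\<close>

lemma not_Units_if_annihilated:
  assumes "x \<in> carrier R" "c \<in> carrier R" "c \<noteq> \<zero>" "c \<otimes> x = \<zero>"
  shows "x \<notin> Units R"
proof
  assume x: "x \<in> Units R"
  have "c = c \<otimes> (x \<otimes> inv x)" using x assms by simp
  also have "\<dots> = (c \<otimes> x) \<otimes> inv x" using x assms(1,2) by (simp add: m_assoc)
  also have "\<dots> = \<zero>" using x assms(4) by simp
  finally show False using assms(3) by blast
qed

lemma GSWNC_nonunit:
  assumes "GSWNC R" "x \<in> carrier R" "x \<notin> Units R"
  shows "nilpotent_el R (x \<otimes> x \<ominus> x) \<or> nilpotent_el R (x \<otimes> x \<oplus> x)"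
  using assms swnc_el_iff unfolding GSWNC_def by blast

lemma minus_eq_zero_iff:
  assumes "a \<in> carrier R" "b \<in> carrier R"
  shows "a \<ominus> b = \<zero> \<longleftrightarrow> a = b" "a \<oplus> b = \<zero> \<longleftrightarrow> a = \<ominus> b"
proof -
  show "a \<ominus> b = \<zero> \<longleftrightarrow> a = b" using assms by (simp add: r_right_minus_eq)
  show "a \<oplus> b = \<zero> \<longleftrightarrow> a = \<ominus> b"
    using assms by (metis a_inv_closed minus_equality l_neg minus_minus)
qed

lemma nilpotent_el_zero: "nilpotent_el R \<zero>"
  unfolding nilpotent_el_def by (auto intro!: exI[of _ "1::nat"])

lemma swnc_el_if_square:
  assumes "x \<in> carrier R" "x \<otimes> x = x \<or> x \<otimes> x = \<ominus> x"
  shows "swnc_el R x"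
proof -
  have "x \<otimes> x \<ominus> x = \<zero> \<or> x \<otimes> x \<oplus> x = \<zero>"
    using assms minus_eq_zero_iff by simp
  then show ?thesis using swnc_el_iff[OF assms(1)] nilpotent_el_zero by metis
qed

end

locale reduced_ring = ring +
  assumes reduced: "a \<in> carrier R \<Longrightarrow> a \<otimes> a = \<zero> \<Longrightarrow> a = \<zero>"
begin

text \<open>Both \<open>p s q\<close> and \<open>q s p\<close> square to zero because
  \<open>p q = q p = 0\<close>, so they vanish and \<open>p s = p s p = s p\<close>.\<close>

lemma idempotent_central:
  assumes p: "p \<in> carrier R" "p \<otimes> p = p" and s: "s \<in> carrier R"
  shows "p \<otimes> s = s \<otimes> p"
proof -
  define q where "q = \<one> \<ominus> p"
  have q: "q \<in> carrier R" unfolding q_def using p by simp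
  have pq: "p \<otimes> q = \<zero>" "q \<otimes> p = \<zero>"
    unfolding q_def using p by (simp_all add: minus_eq l_distr r_distr l_minus r_minus r_neg)
  have "(p \<otimes> s \<otimes> q) \<otimes> (p \<otimes> s \<otimes> q) = p \<otimes> s \<otimes> (q \<otimes> p) \<otimes> s \<otimes> q"
    "(q \<otimes> s \<otimes> p) \<otimes> (q \<otimes> s \<otimes> p) = q \<otimes> s \<otimes> (p \<otimes> q) \<otimes> s \<otimes> p"
    using p(1) q s by (simp_all add: m_assoc)
  then have "p \<otimes> s \<otimes> q = \<zero>" "q \<otimes> s \<otimes> p = \<zero>"
    using pq p(1) q s by (auto intro!: reduced)
  moreover have "p \<otimes> s = p \<otimes> s \<otimes> p \<oplus> p \<otimes> s \<otimes> q" "s \<otimes> p = p \<otimes> s \<otimes> p \<oplus> q \<otimes> s \<otimes> p"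
  proof -
    have "p \<otimes> s \<otimes> p \<oplus> p \<otimes> s \<otimes> q = p \<otimes> s \<otimes> \<one>" "p \<otimes> s \<otimes> p \<oplus> q \<otimes> s \<otimes> p = \<one> \<otimes> s \<otimes> p"
      unfolding q_def using p(1) s by algebra+
    then show "p \<otimes> s = p \<otimes> s \<otimes> p \<oplus> p \<otimes> s \<otimes> q" "s \<otimes> p = p \<otimes> s \<otimes> p \<oplus> q \<otimes> s \<otimes> p"
      using p(1) s by auto
  qed
  ultimately show ?thesis using p(1) s by simp
qed

lemma GSWNC_nonunit_square:
  assumes "GSWNC R" "x \<in> carrier R" "x \<notin> Units R"
  shows "x \<otimes> x = x \<or> x \<otimes> x = \<ominus> x"
proof -
  have "z = \<zero>" if "nilpotent_el R z" for z
    using that nilpotent_eq_zero[of "carrier R"] reduced unfolding nilpotent_el_def by blast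
  then show ?thesis
    using GSWNC_nonunit[OF assms] assms(2) minus_eq_zero_iff by (metis m_closed)
qed

text \<open>Since \<open>q\<close> kills \<open>z = y p\<close>, \<open>z\<close> is a non-unit,
  whence \<open>z^2 = z\<close> or \<open>z^2 = -z\<close> and \<open>r = z^2\<close> is an
  idempotent below \<open>p\<close>. A splitting of \<open>p\<close> into nonzero \<open>r\<close>
  and \<open>p - r\<close> would force \<open>2r = 0\<close> and \<open>2(p - r) = 0\<close>,
  against \<open>2p\<close> being nonzero.\<close>

lemma corner_signs:
  assumes G: "GSWNC R"
    and p: "p \<in> carrier R" "p \<otimes> p = p" "p \<oplus> p \<noteq> \<zero>"
    and q: "q \<in> carrier R" "q \<otimes> q = q" "q \<oplus> q \<noteq> \<zero>"
    and pq: "p \<otimes> q = \<zero>" and y: "y \<in> carrier R"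
  shows "y \<otimes> p \<in> {\<zero>, p, \<ominus> p}"
proof -
  have qp: "q \<otimes> p = \<zero>" using idempotent_central[OF p(1,2) q(1)] pq by simp
  have q0: "q \<noteq> \<zero>" using q(3) by auto
  \<comment> \<open>The annihilator \<open>d\<close> makes \<open>r - q\<close> a non-unit. Its
    square \<open>r + q\<close> must be \<open>r - q\<close> or \<open>-(r - q)\<close>, that is
    \<open>2q = 0\<close> or \<open>2r = 0\<close>; the former is excluded.\<close>
  have dbl: "r \<oplus> r = \<zero>"
    if r: "r \<in> carrier R" "r \<otimes> r = r" "r \<otimes> q = \<zero>"
      and d: "d \<in> carrier R" "d \<noteq> \<zero>" "d \<otimes> r = \<zero>" "d \<otimes> q = \<zero>" for r d
  proof -
    have qr: "q \<otimes> r = \<zero>" using idempotent_central[OF q(1,2) r(1)] r(3) by simp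
    have "d \<otimes> (r \<ominus> q) = \<zero>" using r d q(1) by (simp add: minus_eq r_distr r_minus)
    then have "(r \<ominus> q) \<otimes> (r \<ominus> q) = r \<ominus> q \<or> (r \<ominus> q) \<otimes> (r \<ominus> q) = \<ominus> (r \<ominus> q)"
      using GSWNC_nonunit_square[OF G] not_Units_if_annihilated[of "r \<ominus> q" d] r(1) d q(1) by simp
    moreover have "(r \<ominus> q) \<otimes> (r \<ominus> q) = r \<oplus> q"
      using r q qr by (simp add: minus_eq l_distr r_distr l_minus r_minus)
    ultimately have "r \<oplus> q = r \<ominus> q \<or> r \<oplus> q = \<ominus> (r \<ominus> q)" by simp
    moreover have "q \<oplus> q = (r \<oplus> q) \<ominus> (r \<ominus> q)" "r \<oplus> r = (r \<oplus> q) \<oplus> (r \<ominus> q)"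
      using r(1) q(1) by algebra+
    ultimately show ?thesis
      using q(3) r(1) q(1) by (metis a_closed minus_closed minus_eq_zero_iff)
  qed
  define z where "z = y \<otimes> p"
  have z: "z \<in> carrier R" "z \<otimes> p = z" unfolding z_def using y p by (simp_all add: m_assoc)
  have zq: "z \<otimes> q = \<zero>" unfolding z_def using y p q pq by (simp add: m_assoc)
  then have qz: "q \<otimes> z = \<zero>" using idempotent_central[OF q(1,2) z(1)] by simp
  have zz: "z \<otimes> z = z \<or> z \<otimes> z = \<ominus> z"
    using GSWNC_nonunit_square[OF G z(1)] not_Units_if_annihilated[OF z(1) q(1) q0 qz] by blast
  define r where "r = z \<otimes> z"
  have r: "r \<in> carrier R" "r \<otimes> r = r" "r \<otimes> p = r" "r \<otimes> q = \<zero>"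
    using zz z zq p q unfolding r_def by (auto simp: m_assoc l_minus r_minus)
  have "r = \<zero> \<or> p \<ominus> r = \<zero>"
  proof (rule ccontr)
    assume no: "\<not> ?thesis"
    define d where "d = p \<ominus> r"
    have pr: "p \<otimes> r = r" using idempotent_central[OF p(1,2) r(1)] r(3) by simp
    have d: "d \<in> carrier R" "d \<otimes> d = d" "d \<otimes> q = \<zero>" "d \<otimes> r = \<zero>" "r \<otimes> d = \<zero>"
      unfolding d_def using p q r pr pq
      by (auto simp: minus_eq l_distr r_distr l_minus r_minus r_neg)
    have "r \<oplus> r = \<zero>" "d \<oplus> d = \<zero>"
      using dbl[OF r(1,2,4), of d] dbl[OF d(1,2,3), of r] d r no unfolding d_def by auto
    moreover have "p \<oplus> p = (r \<oplus> r) \<oplus> (d \<oplus> d)" unfolding d_def using p(1) r(1) by algebra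
    ultimately show False using p(3) by simp
  qed
  then have "r = \<zero> \<or> r = p" using p(1) r(1) minus_eq_zero_iff by metis
  then have "z = \<zero> \<or> z = p \<or> z = \<ominus> p"
    using reduced[OF z(1)] zz z(1) unfolding r_def by (metis minus_minus)
  then show ?thesis unfolding z_def by blast
qed

text \<open>If some \<open>x\<close> is not strongly weakly nil-clean, the idempotents decide. With
  only 0 and 1, a non-unit \<open>y\<close> has \<open>y^2\<close> idempotent, so
  \<open>y = 0\<close> by reducedness, and the ring is a division ring. Otherwise \<open>x\<close>
  itself reveals that 2 kills neither \<open>p\<close> nor \<open>q\<close>.\<close>

lemma GSWNC_cases:
  assumes G: "GSWNC R"
  obtains "swnc_ring R"
  | "\<one> \<noteq> \<zero>" "Units R = carrier R - {\<zero>}"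
  | p q where "p \<in> carrier R" "p \<otimes> p = p" "q \<in> carrier R" "q \<otimes> q = q" "p \<oplus> q = \<one>"
      "p \<otimes> q = \<zero>" "q \<otimes> p = \<zero>" "p \<oplus> p \<noteq> \<zero>" "q \<oplus> q \<noteq> \<zero>"
proof (cases "swnc_ring R")
  case False
  then obtain x where x: "x \<in> carrier R" "\<not> swnc_el R x" unfolding swnc_ring_def by blast
  then have xx: "x \<otimes> x \<noteq> x" "x \<otimes> x \<noteq> \<ominus> x" using swnc_el_if_square by blast+
  have xU: "x \<in> Units R" using x G unfolding GSWNC_def by blast
  have one: "\<one> \<noteq> \<zero>" using one_zeroD x(1) xx(1) by (metis r_null singletonD)
  show ?thesis
  proof (cases "\<forall>p \<in> carrier R. p \<otimes> p = p \<longrightarrow> p = \<zero> \<or> p = \<one>")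
    case True
    have "y \<in> Units R" if y: "y \<in> carrier R" "y \<noteq> \<zero>" for y
    proof (rule ccontr)
      assume "y \<notin> Units R"
      then have yy: "y \<otimes> y = y \<or> y \<otimes> y = \<ominus> y" using GSWNC_nonunit_square[OF G y(1)] by blast
      then have "(y \<otimes> y) \<otimes> (y \<otimes> y) = y \<otimes> y" using y by (auto simp: l_minus r_minus)
      then have "y \<otimes> y = \<zero> \<or> y \<otimes> y = \<one>" using True y by blast
      then have "y \<otimes> y = \<one>" using reduced y by blast
      then show False using \<open>y \<notin> Units R\<close> y(1) unfolding Units_def by blast
    qed
    moreover have "\<zero> \<notin> Units R" using not_Units_if_annihilated[of \<zero> \<one>] one by simp
    ultimately have "Units R = carrier R - {\<zero>}" by blast
    then show ?thesis using that(2) one by blast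
  next
    case no: False
    then obtain p where p: "p \<in> carrier R" "p \<otimes> p = p" "p \<noteq> \<zero>" "p \<noteq> \<one>" by blast
    define q where "q = \<one> \<ominus> p"
    have q: "q \<in> carrier R" "q \<otimes> q = q" "q \<noteq> \<zero>" "p \<otimes> q = \<zero>" "q \<otimes> p = \<zero>" "p \<oplus> q = \<one>"
    proof -
      show "q \<in> carrier R" unfolding q_def using p by simp
      show "q \<noteq> \<zero>" unfolding q_def using p minus_eq_zero_iff by auto
      show pq: "p \<otimes> q = \<zero>" "q \<otimes> p = \<zero>"
        unfolding q_def using p by (simp_all add: minus_eq l_distr r_distr l_minus r_minus r_neg)
      show "p \<oplus> q = \<one>" unfolding q_def using p(1) by algebra
      have "q \<otimes> q = q \<ominus> q \<otimes> p"
        using \<open>q \<in> carrier R\<close> p(1) by (subst (2) q_def) (simp add: minus_eq r_distr r_minus)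
      then show "q \<otimes> q = q" using pq \<open>q \<in> carrier R\<close> by (simp add: minus_eq)
    qed
    \<comment> \<open>The component \<open>x u\<close> is killed by \<open>v\<close>, so its square
      is \<open>x u\<close> or \<open>-x u\<close>; cancelling the unit \<open>x\<close> leaves a
      sign.\<close>
    have sgn: "x \<otimes> u = u \<or> x \<otimes> u = \<ominus> u"
      if u: "u \<in> carrier R" "u \<otimes> u = u" and v: "v \<in> carrier R" "v \<noteq> \<zero>" "u \<otimes> v = \<zero>" for u v
    proof -
      have xu: "x \<otimes> u = u \<otimes> x" using idempotent_central[OF u x(1)] by simp
      have vu: "v \<otimes> u = \<zero>" using idempotent_central[OF u v(1)] v(3) by simp
      have "v \<otimes> (x \<otimes> u) = (v \<otimes> u) \<otimes> x" using xu u v(1) x by (simp add: m_assoc)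
      then have "v \<otimes> (x \<otimes> u) = \<zero>" using vu x by simp
      then have sq: "(x \<otimes> u) \<otimes> (x \<otimes> u) = x \<otimes> u \<or> (x \<otimes> u) \<otimes> (x \<otimes> u) = \<ominus> (x \<otimes> u)"
        using GSWNC_nonunit_square[OF G] not_Units_if_annihilated[of "x \<otimes> u" v] v u(1) x(1) by simp
      have "(x \<otimes> u) \<otimes> (x \<otimes> u) = x \<otimes> (u \<otimes> x) \<otimes> u" using x(1) u(1) by (simp add: m_assoc)
      also have "\<dots> = x \<otimes> x \<otimes> (u \<otimes> u)"
        unfolding xu[symmetric] using x(1) u(1) by (simp add: m_assoc)
      finally have "x \<otimes> (x \<otimes> u) = x \<otimes> u \<or> x \<otimes> (x \<otimes> u) = x \<otimes> (\<ominus> u)"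
        using sq x(1) u by (simp add: m_assoc r_minus)
      then show ?thesis using xU x(1) u(1) by (metis Units_l_cancel a_inv_closed m_closed)
    qed
    have xpq: "x = x \<otimes> p \<oplus> x \<otimes> q"
      using x(1) p(1) q(1,6) by (metis r_distr r_one)
    have sq: "u \<otimes> u = p \<oplus> q" if "u = p \<ominus> q \<or> u = q \<ominus> p" for u
      using that p q by (auto simp: minus_eq l_distr r_distr l_minus r_minus a_ac)
    \<comment> \<open>Equal signs on both components would make \<open>x\<close> equal to 1 or -1,
      which \<open>xx\<close> forbids.\<close>
    have "x = p \<ominus> q \<or> x = q \<ominus> p"
    proof -
      have "x \<noteq> \<one>" using xx by auto
      moreover have "x \<noteq> \<ominus> \<one>" using xx by (auto simp: l_minus)
      moreover have "\<ominus> p \<oplus> \<ominus> q = \<ominus> \<one>" using q(6) p(1) q(1) by (metis minus_add)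
      moreover have "\<ominus> p \<oplus> q = q \<ominus> p" "p \<oplus> \<ominus> q = p \<ominus> q"
        using p(1) q(1) by (simp_all add: minus_eq a_comm)
      ultimately show ?thesis
        using xpq sgn[OF p(1,2) q(1,3,4)] sgn[OF q(1,2) p(1,3) q(5)] q(6) by auto
    qed
    \<comment> \<open>In either case \<open>x^2 = p + q\<close>. These rewritings show that
      \<open>2p = 0\<close> or \<open>2q = 0\<close> would turn \<open>x\<close> or
      \<open>-x\<close> into \<open>p + q\<close>, again contradicting \<open>xx\<close>.\<close>
    moreover have "p \<ominus> q = (p \<oplus> q) \<ominus> (q \<oplus> q)" "q \<ominus> p = (p \<oplus> q) \<ominus> (p \<oplus> p)"
      "\<ominus> (p \<ominus> q) = (p \<oplus> q) \<ominus> (p \<oplus> p)" "\<ominus> (q \<ominus> p) = (p \<oplus> q) \<ominus> (q \<oplus> q)"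
      using p(1) q(1) by algebra+
    moreover have "(p \<oplus> q) \<ominus> \<zero> = p \<oplus> q" using p(1) q(1) by (simp add: minus_eq)
    ultimately have "p \<oplus> p \<noteq> \<zero>" "q \<oplus> q \<noteq> \<zero>"
      using xx sq by metis+
    then show ?thesis using that(3) p q by blast
  qed
qed (use that in blast)

end

section \<open>Matrix units\<close>

context ring
begin

text \<open>On \<open>g = xy + yx\<close>, the identity matrix of the corner ring spanned by the matrix units, the element
  \<open>A = x + y + yx\<close> satisfies \<open>A\<^sup>2 = A + g\<close>. Hence \<open>A\<^sup>2 - A = g\<close> is idempotent, and \<open>B = A\<^sup>2 + A\<close> has the
  inverse \<open>B - 4 g\<close> in the corner. If \<open>g \<noteq> 1\<close>, then \<open>A\<close> is not a unit.\<close>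

lemma matrix_units_sum:
  assumes G: "GSWNC R"
    and x: "x \<in> carrier R" "x \<noteq> \<zero>" "x \<otimes> x = \<zero>" and y: "y \<in> carrier R" "y \<otimes> y = \<zero>"
    and xyx: "x \<otimes> y \<otimes> x = x" and yxy: "y \<otimes> x \<otimes> y = y"
  shows "x \<otimes> y \<oplus> y \<otimes> x = \<one>"
proof (rule ccontr)
  define e where "e = x \<otimes> y"
  define f where "f = y \<otimes> x"
  have c: "e \<in> carrier R" "f \<in> carrier R" unfolding e_def f_def using x y by auto
  note cs = x(1) y(1) c
  have l0: "u \<otimes> (v \<otimes> w) = \<zero>" if "u \<otimes> v = \<zero>" "u \<in> carrier R" "v \<in> carrier R" "w \<in> carrier R" for u v w
    using that by (simp flip: m_assoc)
  have tab: "x \<otimes> y = e" "y \<otimes> x = f" "e \<otimes> x = x" "f \<otimes> y = y" "x \<otimes> f = x" "y \<otimes> e = y"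
    "e \<otimes> e = e" "f \<otimes> f = f" "e \<otimes> f = \<zero>" "f \<otimes> e = \<zero>"
    "x \<otimes> e = \<zero>" "f \<otimes> x = \<zero>" "y \<otimes> f = \<zero>" "e \<otimes> y = \<zero>"
    using x y xyx yxy l0 unfolding e_def f_def by (simp_all add: m_assoc)
  define g where "g = e \<oplus> f"
  define A where "A = x \<oplus> y \<oplus> f"
  have gA: "g \<in> carrier R" "A \<in> carrier R" unfolding g_def A_def using cs by auto
  have m: "g \<otimes> g = g" "g \<otimes> A = A" "A \<otimes> g = A" "A \<otimes> A = A \<oplus> g" "g \<otimes> x = x"
    unfolding g_def A_def using cs x(3) y(2) by (simp_all add: l_distr r_distr tab a_ac)
  assume "x \<otimes> y \<oplus> y \<otimes> x \<noteq> \<one>"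
  then have "g \<noteq> \<one>" unfolding g_def e_def f_def .
  then have "\<one> \<ominus> g \<noteq> \<zero>" using gA(1) minus_eq_zero_iff(1)[of \<one> g] by auto
  moreover have "(\<one> \<ominus> g) \<otimes> A = \<zero>" using gA m by (simp add: minus_eq l_distr l_minus r_neg)
  ultimately have "A \<notin> Units R" using not_Units_if_annihilated[of A "\<one> \<ominus> g"] gA by simp
  then have nil: "nilpotent_el R (A \<otimes> A \<ominus> A) \<or> nilpotent_el R (A \<otimes> A \<oplus> A)"
    using GSWNC_nonunit[OF G gA(2)] by blast
  have "nilpotent_el R g"
    using nil
  proof
    have "A \<otimes> A \<ominus> A = g" unfolding m(4) using gA by algebra
    then show "nilpotent_el R (A \<otimes> A \<ominus> A) \<Longrightarrow> nilpotent_el R g" by simp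
  next
    assume n: "nilpotent_el R (A \<otimes> A \<oplus> A)"
    define B where "B = A \<otimes> A \<oplus> A"
    define C where "C = B \<ominus> (g \<oplus> g \<oplus> g \<oplus> g)"
    have B: "B = A \<oplus> A \<oplus> g" unfolding B_def m(4) using gA by algebra
    have Bc: "B \<in> carrier R" "C \<in> carrier R" unfolding C_def B using gA by auto
    have gB: "g \<otimes> B = B" "B \<otimes> g = B"
      unfolding B using gA m by (simp_all add: l_distr r_distr)
    have "A \<otimes> B = A \<oplus> g \<oplus> (A \<oplus> g) \<oplus> A"
      unfolding B using gA m by (simp add: r_distr)
    also have "\<dots> = B \<oplus> A \<oplus> g" unfolding B using gA by (simp add: a_ac)
    finally have AB: "A \<otimes> B = B \<oplus> A \<oplus> g" .
    \<comment> \<open>From \<open>B = 2A + g\<close> one gets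
      \<open>B^2 = 4(A^2 + A) + g = 4B + g\<close>, which is where the inverse \<open>B - 4g\<close>
      comes from.\<close>
    have "B \<otimes> B = A \<otimes> B \<oplus> A \<otimes> B \<oplus> g \<otimes> B"
      using gA Bc by (subst (1) B) (simp add: l_distr)
    also have "\<dots> = (B \<oplus> B \<oplus> B) \<oplus> (A \<oplus> A \<oplus> g) \<oplus> g"
      unfolding AB gB using gA Bc by (simp add: a_ac)
    finally have BB: "B \<otimes> B = (B \<oplus> B \<oplus> B \<oplus> B) \<oplus> g" unfolding B[symmetric] .
    have "B \<otimes> C = g" "C \<otimes> B = g"
    proof -
      have "B \<otimes> C = B \<otimes> B \<ominus> (B \<otimes> g \<oplus> B \<otimes> g \<oplus> B \<otimes> g \<oplus> B \<otimes> g)"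
        "C \<otimes> B = B \<otimes> B \<ominus> (g \<otimes> B \<oplus> g \<otimes> B \<oplus> g \<otimes> B \<oplus> g \<otimes> B)"
        unfolding C_def using gA Bc(1) by (simp_all add: minus_eq l_distr r_distr l_minus r_minus)
      moreover have "u \<oplus> g \<ominus> u = g" if "u \<in> carrier R" for u
        using that gA(1) by algebra
      ultimately show "B \<otimes> C = g" "C \<otimes> B = g" unfolding gB BB using Bc(1) by simp_all
    qed
    then show "nilpotent_el R g"
      using nilpotent_mult_commute[of B C] n Bc unfolding B_def by metis
  qed
  then obtain n :: nat where n: "g [^] n = \<zero>" unfolding nilpotent_el_def by blast
  \<comment> \<open>No power of \<open>g\<close> can vanish, because \<open>g\<close> fixes the
    nonzero \<open>x\<close>.\<close>
  have "g [^] n \<otimes> x = x" by (induction n) (use gA m x(1) in \<open>simp_all add: m_assoc\<close>)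
  then show False using n x by simp
qed

text \<open>Regularity supplies an inner inverse, which is corrected in three stages: moved into the
  corner of \<open>e\<close>, made reflexive, and finally made square-zero.\<close>

lemma exists_matrix_units:
  assumes reg: "\<And>a. a \<in> carrier R \<Longrightarrow> \<exists>y \<in> carrier R. a \<otimes> y \<otimes> a = a"
    and e: "e \<in> carrier R" "e \<otimes> e = e"
    and d: "d \<in> carrier R" "e \<otimes> d = d" "d \<otimes> e = d" "d \<otimes> d = \<zero>"
  shows "\<exists>y \<in> carrier R. e \<otimes> y = y \<and> y \<otimes> y = \<zero> \<and> d \<otimes> y \<otimes> d = d \<and> y \<otimes> d \<otimes> y = y"
proof -
  obtain u where u: "u \<in> carrier R" "d \<otimes> u \<otimes> d = d" using reg[OF d(1)] by blast
  have la: "v \<otimes> (w \<otimes> z) = t \<otimes> z" if "v \<otimes> w = t" "v \<in> carrier R" "w \<in> carrier R" "z \<in> carrier R" for v w z t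
    using that by (simp flip: m_assoc)
  define v where "v = e \<otimes> u \<otimes> e"
  have v: "v \<in> carrier R" "d \<otimes> (v \<otimes> d) = d" "e \<otimes> v = v"
    unfolding v_def using u e d la[OF d(3)] la[OF e(2)] by (simp_all add: m_assoc)
  \<comment> \<open>The usual passage from \<open>d v d = d\<close> to a reflexive inverse, with
    \<open>d w d = d\<close> and \<open>w d w = w\<close>.\<close>
  define w where "w = v \<otimes> d \<otimes> v"
  have dv: "d \<otimes> (v \<otimes> (d \<otimes> z)) = d \<otimes> z" if "z \<in> carrier R" for z
    using v(2) that d(1) v(1) by (metis m_assoc m_closed)
  have w: "w \<in> carrier R" "d \<otimes> (w \<otimes> d) = d" "w \<otimes> (d \<otimes> w) = w" "e \<otimes> w = w"
    unfolding w_def using v d(1) dv e(1) la[OF v(3)] by (simp_all add: m_assoc)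
  have dd: "d \<otimes> (d \<otimes> z) = \<zero>" if "z \<in> carrier R" for z
    using la[OF d(4)] d(1) that by simp
  have dw: "d \<otimes> (w \<otimes> (d \<otimes> z)) = d \<otimes> z" if "z \<in> carrier R" for z
    using w(2) that d(1) w(1) by (metis m_assoc m_closed)
  have wd: "w \<otimes> (d \<otimes> (w \<otimes> z)) = w \<otimes> z" if "z \<in> carrier R" for z
    using w(3) that d(1) w(1) by (metis m_assoc m_closed)
  \<comment> \<open>Here \<open>y = (1 - d w) w\<close>, and \<open>w (1 - d w) = 0\<close> yields
    \<open>y^2 = 0\<close>. Because \<open>d^2 = 0\<close>, the correction is invisible after left
    multiplication by \<open>d\<close>, so both inverse identities persist.\<close>
  define y where "y = w \<ominus> d \<otimes> w \<otimes> w"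
  have y: "y \<in> carrier R" "e \<otimes> y = y" "y \<otimes> y = \<zero>" "d \<otimes> y \<otimes> d = d" "y \<otimes> d \<otimes> y = y"
    unfolding y_def using w d e(1) dd dw wd la[OF d(2)] la[OF w(4)]
    by (simp_all add: minus_eq l_distr r_distr l_minus r_minus m_assoc r_neg)
  then show ?thesis by blast
qed

text \<open>The corner \<open>D = e R e\<close> is reduced and has no idempotents besides 0 and
  \<open>e\<close>. Each \<open>d\<close> in \<open>D\<close> is a non-unit, being killed by
  \<open>f\<close>, so \<open>d^2 = d\<close> or \<open>d^2 = -d\<close>, and the idempotent
  \<open>d^2\<close> is 0 or \<open>e\<close>.\<close>

lemma matrix_units_corner:
  assumes G: "GSWNC R"
    and reg: "\<And>a. a \<in> carrier R \<Longrightarrow> \<exists>y \<in> carrier R. a \<otimes> y \<otimes> a = a"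
    and x: "x \<in> carrier R" "x \<noteq> \<zero>" "x \<otimes> x = \<zero>" and y: "y \<in> carrier R" "y \<otimes> y = \<zero>"
    and xyx: "x \<otimes> y \<otimes> x = x" and yxy: "y \<otimes> x \<otimes> y = y"
    and d: "d \<in> carrier R" "x \<otimes> y \<otimes> d = d" "d \<otimes> (x \<otimes> y) = d"
  shows "d \<in> {\<zero>, x \<otimes> y, \<ominus> (x \<otimes> y)}"
proof -
  define e where "e = x \<otimes> y"
  define f where "f = y \<otimes> x"
  define D where "D = {d \<in> carrier R. e \<otimes> d = d \<and> d \<otimes> e = d}"
  have c: "e \<in> carrier R" "f \<in> carrier R" unfolding e_def f_def using x y by auto
  have l0: "u \<otimes> (v \<otimes> w) = \<zero>" if "u \<otimes> v = \<zero>" "u \<in> carrier R" "v \<in> carrier R" "w \<in> carrier R" for u v w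
    using that by (simp flip: m_assoc)
  have tab: "e \<otimes> e = e" "f \<otimes> e = \<zero>" "e \<otimes> f = \<zero>" "x \<otimes> e = \<zero>" "e \<otimes> y = \<zero>" "y \<otimes> e = y" "e \<otimes> x = x" "x \<otimes> f = x"
    using x y xyx yxy l0 unfolding e_def f_def by (simp_all add: m_assoc)
  have ef: "e \<oplus> f = \<one>"
    using matrix_units_sum[OF G x y xyx yxy] unfolding e_def f_def .
  have f0: "f \<noteq> \<zero>" using tab(8) x by auto
  have e0: "e \<noteq> \<zero>" using tab(7) x by auto
  have Dc: "d \<in> carrier R" "e \<otimes> d = d" "d \<otimes> e = d" if "d \<in> D" for d
    using that unfolding D_def by auto
  have fD: "f \<otimes> d = \<zero>" if "d \<in> D" for d
    using Dc[OF that] c tab(2) by (metis m_assoc l_null)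
  have Dmult: "a \<otimes> b \<in> D" if "a \<in> D" "b \<in> D" for a b
    using Dc[OF that(1)] Dc[OF that(2)] c unfolding D_def
    by (simp add: m_assoc) (metis m_assoc)
  have Dadd: "a \<ominus> b \<in> D" "a \<oplus> b \<in> D" if "a \<in> D" "b \<in> D" for a b
    using Dc[OF that(1)] Dc[OF that(2)] c unfolding D_def
    by (simp_all add: minus_eq l_distr r_distr l_minus r_minus)
  \<comment> \<open>A nonzero square-zero \<open>a\<close> has a partner \<open>z\<close> in
    \<open>e R\<close>; their matrix units sum to 1, although left multiplication by
    \<open>f\<close> kills both \<open>a\<close> and \<open>z\<close>.\<close>
  have Dred: "a = \<zero>" if a: "a \<in> D" "a \<otimes> a = \<zero>" for a
  proof (rule ccontr)
    assume a0: "a \<noteq> \<zero>"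
    obtain z where z: "z \<in> carrier R" "e \<otimes> z = z" "z \<otimes> z = \<zero>" "a \<otimes> z \<otimes> a = a" "z \<otimes> a \<otimes> z = z"
      using exists_matrix_units[OF reg c(1) tab(1)] Dc[OF a(1)] a(2) by blast
    have "a \<otimes> z \<oplus> z \<otimes> a = \<one>"
      using matrix_units_sum[OF G Dc(1)[OF a(1)] a0 a(2) z(1,3,4,5)] .
    then have "f = f \<otimes> (a \<otimes> z \<oplus> z \<otimes> a)" using c by simp
    also have "\<dots> = (f \<otimes> a) \<otimes> z \<oplus> (f \<otimes> z) \<otimes> a"
      using c z(1) Dc(1)[OF a(1)] by (simp add: r_distr m_assoc)
    also have "f \<otimes> z = \<zero>" using z c tab(2) by (metis m_assoc l_null)
    finally show False using f0 fD[OF a(1)] z(1) Dc(1)[OF a(1)] by simp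
  qed
  have Dnil: "a = \<zero>" if "a \<in> D" "nilpotent_el R a" for a
    using nilpotent_eq_zero[of D a] Dc(1) Dmult Dred that by blast
  have Didem: "p = \<zero> \<or> p = e" if p: "p \<in> D" "p \<otimes> p = p" for p
  proof (rule disjCI)
    assume p0: "p \<noteq> e"
    show "p = \<zero>"
    proof (rule ccontr)
      assume "p \<noteq> \<zero>"
      note pc = Dc[OF p(1)]
      have as: "a \<otimes> (b \<otimes> z) = t \<otimes> z" if "a \<otimes> b = t" "a \<in> carrier R" "b \<in> carrier R" "z \<in> carrier R" for a b z t
        using that by (simp flip: m_assoc)
      have xp: "x \<otimes> p = \<zero>" using pc c tab(4) x(1) by (metis m_assoc l_null)
      have py: "p \<otimes> y = \<zero>" using pc c tab(5) y(1) by (metis m_assoc r_null)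
      \<comment> \<open>Cutting the matrix units down by \<open>p\<close> gives units with diagonal
        idempotents \<open>p\<close> and \<open>y p x\<close>. Their sum is 1, and multiplying by
        \<open>e\<close> leaves \<open>p = e\<close>.\<close>
      let ?x = "p \<otimes> x" and ?y = "y \<otimes> p"
      have xy: "?x \<otimes> ?y = p"
      proof -
        have "?x \<otimes> ?y = p \<otimes> e \<otimes> p" unfolding e_def using pc x y by (simp add: m_assoc)
        then show ?thesis using pc p(2) by simp
      qed
      have "?x \<otimes> ?x = p \<otimes> (x \<otimes> p) \<otimes> x" "?y \<otimes> ?y = y \<otimes> (p \<otimes> y) \<otimes> p"
        using pc(1) x(1) y(1) by (simp_all add: m_assoc)
      then have sq: "?x \<otimes> ?x = \<zero>" "?y \<otimes> ?y = \<zero>"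
        using xp py pc(1) x(1) y(1) by simp_all
      have t: "?x \<otimes> ?y \<otimes> ?x = ?x" "?y \<otimes> ?x \<otimes> ?y = ?y"
      proof -
        show "?x \<otimes> ?y \<otimes> ?x = ?x" unfolding xy using as[OF p(2)] pc(1) x(1) by simp
        have "?y \<otimes> ?x \<otimes> ?y = ?y \<otimes> (?x \<otimes> ?y)" using pc(1) x(1) y(1) by (simp add: m_assoc)
        then show "?y \<otimes> ?x \<otimes> ?y = ?y" unfolding xy using p(2) pc(1) y(1) by (simp add: m_assoc)
      qed
      have "?x \<noteq> \<zero>" using xy \<open>p \<noteq> \<zero>\<close> pc(1) y(1) by auto
      then have "?x \<otimes> ?y \<oplus> ?y \<otimes> ?x = \<one>"
        using matrix_units_sum[OF G _ _ sq(1) _ sq(2) t] pc(1) x(1) y(1) by simp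
      then have "e \<otimes> (p \<oplus> ?y \<otimes> ?x) = e" unfolding xy using c by simp
      moreover have "e \<otimes> (p \<oplus> ?y \<otimes> ?x) = e \<otimes> p \<oplus> (e \<otimes> y) \<otimes> (p \<otimes> ?x)"
        using pc(1) x(1) y(1) c by (simp add: r_distr m_assoc)
      ultimately show False using p0 tab(5) pc x(1) by simp
    qed
  qed
  have dD: "d \<in> D" using d unfolding D_def e_def by simp
  have "d \<notin> Units R"
    using not_Units_if_annihilated[OF d(1) c(2) f0 fD[OF dD]] .
  then have "nilpotent_el R (d \<otimes> d \<ominus> d) \<or> nilpotent_el R (d \<otimes> d \<oplus> d)"
    using GSWNC_nonunit[OF G d(1)] by blast
  then have "d \<otimes> d \<ominus> d = \<zero> \<or> d \<otimes> d \<oplus> d = \<zero>"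
    using Dnil Dadd[OF Dmult[OF dD dD] dD] by blast
  then have dd: "d \<otimes> d = d \<or> d \<otimes> d = \<ominus> d" using minus_eq_zero_iff d(1) by simp
  then have "(d \<otimes> d) \<otimes> (d \<otimes> d) = d \<otimes> d" using d(1) by (auto simp: l_minus r_minus)
  then have "d \<otimes> d = \<zero> \<or> d \<otimes> d = e" using Didem[OF Dmult[OF dD dD]] by blast
  then have "d = \<zero> \<or> d = e \<or> d = \<ominus> e"
    using Dred[OF dD] dd d(1) by (metis minus_minus)
  then show ?thesis unfolding e_def by blast
qed

lemma add_pow_mod:
  assumes n: "add_pow R n \<one> = \<zero>" and s: "s \<in> carrier R"
  shows "add_pow R (i mod n :: int) s = add_pow R i s"
proof -
  have "add_pow R n s = add_pow R n \<one> \<otimes> s" using s by (simp add: add_pow_ldistr_int)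
  then have ns: "add_pow R n s = \<zero>" using n s by simp
  have "add_pow R i s = add_pow R (n * (i div n) + i mod n) s" by simp
  also have "\<dots> = add_pow R (n * (i div n)) s \<oplus> add_pow R (i mod n) s"
    by (rule add.int_pow_mult[OF s])
  also have "add_pow R (n * (i div n)) s = add_pow R (i div n) (add_pow R n s)"
    using add.int_pow_pow[OF s] by (simp add: mult.commute)
  also have "\<dots> = \<zero>" unfolding ns by simp
  finally show ?thesis using s by simp
qed

end

text \<open>The explicit map runs from coordinates to ring elements, so the isomorphism is obtained
  by inverting it. Closure of \<open>B\<close> under its operations stands in for a ring structure
  on \<open>B\<close>.\<close>

lemma ring_iso_via_inverse:
  assumes k: "bij_betw k (carrier B) (carrier A)"
    and closed: "\<one>\<^bsub>B\<^esub> \<in> carrier B"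
      "\<And>u v. u \<in> carrier B \<Longrightarrow> v \<in> carrier B \<Longrightarrow> u \<otimes>\<^bsub>B\<^esub> v \<in> carrier B \<and> u \<oplus>\<^bsub>B\<^esub> v \<in> carrier B"
    and hom: "k \<one>\<^bsub>B\<^esub> = \<one>\<^bsub>A\<^esub>"
      "\<And>u v. u \<in> carrier B \<Longrightarrow> v \<in> carrier B \<Longrightarrow> k (u \<otimes>\<^bsub>B\<^esub> v) = k u \<otimes>\<^bsub>A\<^esub> k v"
      "\<And>u v. u \<in> carrier B \<Longrightarrow> v \<in> carrier B \<Longrightarrow> k (u \<oplus>\<^bsub>B\<^esub> v) = k u \<oplus>\<^bsub>A\<^esub> k v"
  shows "A \<simeq> B"
proof -
  let ?h = "inv_into (carrier B) k"
  have h: "bij_betw ?h (carrier A) (carrier B)" by (rule bij_betw_inv_into[OF k])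
  then have hc: "?h a \<in> carrier B" if "a \<in> carrier A" for a using that bij_betwE by blast
  have hk: "?h (k u) = u" if "u \<in> carrier B" for u
    using bij_betw_inv_into_left[OF k that] .
  have kh: "k (?h a) = a" if "a \<in> carrier A" for a
    using bij_betw_inv_into_right[OF k that] .
  have "?h \<in> ring_iso A B"
  proof (rule ring_iso_memI)
    fix a b assume ab: "a \<in> carrier A" "b \<in> carrier A"
    show "?h a \<in> carrier B" using hc[OF ab(1)] .
    have "k (?h a \<otimes>\<^bsub>B\<^esub> ?h b) = a \<otimes>\<^bsub>A\<^esub> b" using hom(2) hc kh ab by simp
    then show "?h (a \<otimes>\<^bsub>A\<^esub> b) = ?h a \<otimes>\<^bsub>B\<^esub> ?h b" using hk closed(2) hc ab by metis
    have "k (?h a \<oplus>\<^bsub>B\<^esub> ?h b) = a \<oplus>\<^bsub>A\<^esub> b" using hom(3) hc kh ab by simp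
    then show "?h (a \<oplus>\<^bsub>A\<^esub> b) = ?h a \<oplus>\<^bsub>B\<^esub> ?h b" using hk closed(2) hc ab by metis
  next
    show "?h \<one>\<^bsub>A\<^esub> = \<one>\<^bsub>B\<^esub>" using hk closed(1) hom(1) by metis
  qed (rule h)
  then show ?thesis unfolding is_ring_iso_def by blast
qed

section \<open>Coordinates over the residue rings\<close>

context ring
begin

lemma add_pow_zero: "add_pow R (0::int) s = \<zero>"
  by (simp add: add_pow_def)

lemma add_pow_two: "s \<in> carrier R \<Longrightarrow> add_pow R (2::int) s = s \<oplus> s"
  using add.int_pow_mult[of s 1 1] by simp

lemma add_pow_three: "s \<in> carrier R \<Longrightarrow> add_pow R (3::int) s = s \<oplus> s \<oplus> s"
  using add.int_pow_mult[of s 2 1] by (simp add: add_pow_two)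

text \<open>As \<open>2e = e\<close> is impossible for nonzero \<open>e\<close>, either
  \<open>2e = 0\<close> or \<open>2e = -e\<close>, so \<open>e\<close> has additive order 2 or 3.
  The clause on \<open>n = 2\<close> lets a caller with nonzero \<open>2e\<close> select 3.\<close>

lemma sign_multiples:
  assumes e: "e \<in> carrier R" "e \<noteq> \<zero>" "e \<oplus> e \<in> {\<zero>, e, \<ominus> e}"
  shows "\<exists>n \<in> {2, 3 :: int}. add_pow R n e = \<zero> \<and> (n = 2 \<longrightarrow> e \<oplus> e = \<zero>)
    \<and> (\<forall>i \<in> {0..n - 1}. add_pow R i e = \<zero> \<longrightarrow> i = 0)
    \<and> (\<forall>d \<in> {\<zero>, e, \<ominus> e}. \<exists>i \<in> {0..n - 1}. d = add_pow R i e)"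
proof (cases "e \<oplus> e = \<zero>")
  case True
  then have "\<ominus> e = e" using e(1) minus_equality by blast
  moreover have "{0..1::int} = {0, 1}" by auto
  ultimately show ?thesis
    using True e by (intro bexI[of _ 2]) (auto simp: add_pow_zero add_pow_two)
next
  case False
  have "e \<oplus> e \<noteq> e" using e add.r_cancel_one' by auto
  then have ee: "e \<oplus> e = \<ominus> e" using False e(3) by blast
  moreover have "{0..2::int} = {0, 1, 2}" by auto
  ultimately show ?thesis
    using False e by (intro bexI[of _ 3]) (auto simp: add_pow_zero add_pow_two add_pow_three l_neg)
qed

lemma add_pow_inj:
  assumes n: "add_pow R n \<one> = \<zero>" and e: "e \<in> carrier R"
    and inj: "\<And>i. i \<in> {0..n - 1} \<Longrightarrow> add_pow R i e = \<zero> \<Longrightarrow> i = 0"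
    and ij: "i \<in> {0..n - 1}" "j \<in> {0..n - 1}" "add_pow R i e = add_pow R (j::int) e"
  shows "i = j"
proof -
  have "add_pow R ((i - j) mod n) e = add_pow R (i - j) e" by (rule add_pow_mod[OF n e])
  also have "\<dots> = add_pow R i e \<ominus> add_pow R j e"
    using add.int_pow_mult[OF e, of i "- j"] add.int_pow_neg[OF e, of j]
    by (simp add: minus_eq)
  also have "\<dots> = \<zero>" using ij(3) e by (simp add: minus_eq r_neg)
  finally have "(i - j) mod n = 0" using inj ij(1) by auto
  then show ?thesis using ij by (metis atLeastAtMost_iff mod_eq_dvd_iff mod_pos_pos_trivial zle_diff1_eq mod_eq_0_iff_dvd)
qed

text \<open>The elements \<open>e\<close>, \<open>x\<close>, \<open>y\<close>, \<open>f\<close> are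
  the matrix units E11, E12, E21, E22. Knowledge of the corner \<open>e R e\<close> suffices, since
  \<open>x\<close> and \<open>y\<close> carry the other three corners to it.\<close>

lemma iso_M2_residue_ring:
  assumes c: "e \<in> carrier R" "x \<in> carrier R" "y \<in> carrier R" "f \<in> carrier R"
    and tab: "e \<otimes> e = e" "e \<otimes> x = x" "e \<otimes> y = \<zero>" "e \<otimes> f = \<zero>"
      "x \<otimes> e = \<zero>" "x \<otimes> x = \<zero>" "x \<otimes> y = e" "x \<otimes> f = x"
      "y \<otimes> e = y" "y \<otimes> x = f" "y \<otimes> y = \<zero>" "y \<otimes> f = \<zero>"
      "f \<otimes> e = \<zero>" "f \<otimes> x = \<zero>" "f \<otimes> y = y" "f \<otimes> f = f"
    and one: "e \<oplus> f = \<one>"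
    and n: "1 < n" "add_pow R n \<one> = \<zero>"
    and inj: "\<And>i. i \<in> {0..n - 1} \<Longrightarrow> add_pow R i e = \<zero> \<Longrightarrow> i = 0"
    and corner: "\<And>s. s \<in> carrier R \<Longrightarrow> \<exists>i \<in> {0..n - 1}. e \<otimes> s \<otimes> e = add_pow R i e"
  shows "R \<simeq> M2 (residue_ring n)"
proof -
  let ?B = "M2 (residue_ring n)"
  define k where "k = (\<lambda>(a :: int, b :: int, c :: int, d :: int).
    add_pow R a e \<oplus> add_pow R b x \<oplus> add_pow R c y \<oplus> add_pow R d f)"
  note pc = add.int_pow_closed
  have carB: "carrier ?B = {0..n - 1} \<times> {0..n - 1} \<times> {0..n - 1} \<times> {0..n - 1}"
    by (simp add: M2_def residue_ring_def)
  have kc: "k u \<in> carrier R" for u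
    unfolding k_def using c by (auto split: prod.split)
  note md = add_pow_mod[OF n(2)]
  have prod: "add_pow R i u \<otimes> add_pow R j v = add_pow R (i * j) (u \<otimes> v)"
    if "u \<in> carrier R" "v \<in> carrier R" for u v and i j :: int
    using that by (simp add: add_pow_ldistr_int add_pow_rdistr_int add.int_pow_pow mult.commute)
  \<comment> \<open>Each coordinate is read off as a multiple of the same \<open>e\<close>, so
    injectivity of the multiples of \<open>e\<close> handles all four.\<close>
  have entries: "e \<otimes> k (a, b, p, d) \<otimes> e = add_pow R a e" "e \<otimes> k (a, b, p, d) \<otimes> y = add_pow R b e"
    "x \<otimes> k (a, b, p, d) \<otimes> e = add_pow R p e" "x \<otimes> k (a, b, p, d) \<otimes> y = add_pow R d e" for a b p d
    unfolding k_def using c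
    by (simp_all add: l_distr r_distr add_pow_ldistr_int add_pow_rdistr_int tab)
  have inj_k: "inj_on k (carrier ?B)"
  proof (rule inj_onI)
    fix u v assume uv: "u \<in> carrier ?B" "v \<in> carrier ?B" "k u = k v"
    obtain a b p d where u: "u = (a, b, p, d)" by (cases u)
    obtain a' b' p' d' where v: "v = (a', b', p', d')" by (cases v)
    have "add_pow R a e = add_pow R a' e" "add_pow R b e = add_pow R b' e"
      "add_pow R p e = add_pow R p' e" "add_pow R d e = add_pow R d' e"
      using entries uv(3) unfolding u v by metis+
    moreover have "i = j" if "i \<in> {0..n - 1}" "j \<in> {0..n - 1}" "add_pow R i e = add_pow R j e" for i j
      using add_pow_inj[OF n(2) c(1) inj that] .
    ultimately have "a = a'" "b = b'" "p = p'" "d = d'" using uv(1,2) unfolding u v carB by blast+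
    then show "u = v" unfolding u v by blast
  qed
  have surj_k: "s \<in> k ` carrier ?B" if s: "s \<in> carrier R" for s
  proof -
    obtain a where a: "a \<in> {0..n - 1}" "e \<otimes> s \<otimes> e = add_pow R a e" using corner[OF s] by blast
    obtain b where b: "b \<in> {0..n - 1}" "e \<otimes> (s \<otimes> y) \<otimes> e = add_pow R b e"
      using corner[of "s \<otimes> y"] s c by blast
    obtain p where p: "p \<in> {0..n - 1}" "e \<otimes> (x \<otimes> s) \<otimes> e = add_pow R p e"
      using corner[of "x \<otimes> s"] s c by blast
    obtain d where d: "d \<in> {0..n - 1}" "e \<otimes> (x \<otimes> s \<otimes> y) \<otimes> e = add_pow R d e"
      using corner[of "x \<otimes> s \<otimes> y"] s c by auto
    \<comment> \<open>The Peirce decomposition of \<open>s\<close>; each off-corner piece is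
      rewritten as an element of \<open>e R e\<close> multiplied by \<open>x\<close> on the right or
      \<open>y\<close> on the left.\<close>
    have "s = (e \<oplus> f) \<otimes> s \<otimes> (e \<oplus> f)" unfolding one using s by simp
    also have "\<dots> = e \<otimes> s \<otimes> e \<oplus> e \<otimes> s \<otimes> f \<oplus> f \<otimes> s \<otimes> e \<oplus> f \<otimes> s \<otimes> f"
      using s c by (simp add: l_distr r_distr a_ac)
    also have "e \<otimes> s \<otimes> f = e \<otimes> (s \<otimes> y) \<otimes> e \<otimes> x"
      unfolding tab(10)[symmetric] using s c by (simp add: m_assoc tab(2))
    also have "\<dots> = add_pow R b x" unfolding b(2) using c by (simp add: add_pow_ldistr_int tab)
    also have "f \<otimes> s \<otimes> e = y \<otimes> (e \<otimes> (x \<otimes> s) \<otimes> e)"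
    proof -
      have "y \<otimes> (e \<otimes> (x \<otimes> s) \<otimes> e) = (y \<otimes> e) \<otimes> x \<otimes> s \<otimes> e" using s c by (simp add: m_assoc)
      then show ?thesis by (simp only: tab)
    qed
    also have "\<dots> = add_pow R p y" unfolding p(2) using c by (simp add: add_pow_rdistr_int tab)
    also have "f \<otimes> s \<otimes> f = y \<otimes> (e \<otimes> (x \<otimes> s \<otimes> y) \<otimes> e) \<otimes> x"
    proof -
      have "y \<otimes> (e \<otimes> (x \<otimes> s \<otimes> y) \<otimes> e) \<otimes> x = (y \<otimes> e) \<otimes> x \<otimes> s \<otimes> (y \<otimes> (e \<otimes> x))"
        using s c by (simp add: m_assoc)
      then show ?thesis by (simp only: tab)
    qed
    also have "\<dots> = add_pow R d f"
      unfolding d(2) using c by (simp add: add_pow_ldistr_int add_pow_rdistr_int tab)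
    finally have "s = k (a, b, p, d)" unfolding k_def a(2) by simp
    then show ?thesis using a b p d unfolding carB by blast
  qed
  show ?thesis
  proof (rule ring_iso_via_inverse)
    show "bij_betw k (carrier ?B) (carrier R)"
      unfolding bij_betw_def using inj_k kc surj_k by blast
    show "\<one>\<^bsub>?B\<^esub> \<in> carrier ?B" unfolding carB using n(1) by (simp add: M2_def residue_ring_def)
    show "k \<one>\<^bsub>?B\<^esub> = \<one>" unfolding k_def M2_def residue_ring_def using c one by (simp add: add_pow_zero)
    fix u v assume "u \<in> carrier ?B" "v \<in> carrier ?B"
    obtain a b p d where u: "u = (a, b, p, d)" by (cases u)
    obtain a' b' p' d' where v: "v = (a', b', p', d')" by (cases v)
    have m: "u \<otimes>\<^bsub>?B\<^esub> v = ((a * a' + b * p') mod n, (a * b' + b * d') mod n,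
        (p * a' + d * p') mod n, (p * b' + d * d') mod n)"
      unfolding u v by (simp add: M2_def m2_mult_def residue_ring_def mod_simps)
    have s: "u \<oplus>\<^bsub>?B\<^esub> v = ((a + a') mod n, (b + b') mod n, (p + p') mod n, (d + d') mod n)"
      unfolding u v by (simp add: M2_def m2_add_def residue_ring_def)
    show "u \<otimes>\<^bsub>?B\<^esub> v \<in> carrier ?B \<and> u \<oplus>\<^bsub>?B\<^esub> v \<in> carrier ?B"
      unfolding m s carB using n(1) by simp
    show "k (u \<oplus>\<^bsub>?B\<^esub> v) = k u \<oplus> k v"
      unfolding s unfolding u v k_def using c by (simp add: md add.int_pow_mult a_ac)
    show "k (u \<otimes>\<^bsub>?B\<^esub> v) = k u \<otimes> k v"
      unfolding m unfolding u v k_def using c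
      by (simp add: md add.int_pow_mult l_distr r_distr prod tab a_ac)
  qed
qed

lemma iso_RDirProd_residue_ring:
  assumes c: "p \<in> carrier R" "q \<in> carrier R"
    and tab: "p \<otimes> p = p" "q \<otimes> q = q" "p \<otimes> q = \<zero>" "q \<otimes> p = \<zero>" and one: "p \<oplus> q = \<one>"
    and n: "1 < n" "add_pow R n \<one> = \<zero>"
    and inj: "\<And>i. i \<in> {0..n - 1} \<Longrightarrow> add_pow R i p = \<zero> \<Longrightarrow> i = 0"
      "\<And>i. i \<in> {0..n - 1} \<Longrightarrow> add_pow R i q = \<zero> \<Longrightarrow> i = 0"
    and corner: "\<And>s. s \<in> carrier R \<Longrightarrow> \<exists>i \<in> {0..n - 1}. s \<otimes> p = add_pow R i p"
      "\<And>s. s \<in> carrier R \<Longrightarrow> \<exists>i \<in> {0..n - 1}. s \<otimes> q = add_pow R i q"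
  shows "R \<simeq> RDirProd (residue_ring n) (residue_ring n)"
proof -
  let ?B = "RDirProd (residue_ring n) (residue_ring n)"
  define k where "k = (\<lambda>(a :: int, b :: int). add_pow R a p \<oplus> add_pow R b q)"
  have carB: "carrier ?B = {0..n - 1} \<times> {0..n - 1}"
    by (simp add: RDirProd_carrier residue_ring_def)
  have kc: "k u \<in> carrier R" for u unfolding k_def using c by (auto split: prod.split)
  note md = add_pow_mod[OF n(2)]
  have prod: "add_pow R i u \<otimes> add_pow R j v = add_pow R (i * j) (u \<otimes> v)"
    if "u \<in> carrier R" "v \<in> carrier R" for u v and i j :: int
    using that by (simp add: add_pow_ldistr_int add_pow_rdistr_int add.int_pow_pow mult.commute)
  have entries: "k (a, b) \<otimes> p = add_pow R a p" "k (a, b) \<otimes> q = add_pow R b q" for a b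
    unfolding k_def using c by (simp_all add: l_distr add_pow_ldistr_int tab)
  show ?thesis
  proof (rule ring_iso_via_inverse)
    have "inj_on k (carrier ?B)"
    proof (rule inj_onI)
      fix u v assume uv: "u \<in> carrier ?B" "v \<in> carrier ?B" "k u = k v"
      obtain a b where u: "u = (a, b)" by (cases u)
      obtain a' b' where v: "v = (a', b')" by (cases v)
      have "add_pow R a p = add_pow R a' p" "add_pow R b q = add_pow R b' q"
        using entries uv(3) unfolding u v by metis+
      moreover have "i = j" if "i \<in> {0..n - 1}" "j \<in> {0..n - 1}" "add_pow R i p = add_pow R j p" for i j
        using add_pow_inj[OF n(2) c(1) inj(1) that] .
      moreover have "i = j" if "i \<in> {0..n - 1}" "j \<in> {0..n - 1}" "add_pow R i q = add_pow R j q" for i j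
        using add_pow_inj[OF n(2) c(2) inj(2) that] .
      ultimately have "a = a'" "b = b'" using uv(1,2) unfolding u v carB by blast+
      then show "u = v" unfolding u v by blast
    qed
    moreover have "s \<in> k ` carrier ?B" if s: "s \<in> carrier R" for s
    proof -
      obtain a b where ab: "a \<in> {0..n - 1}" "s \<otimes> p = add_pow R a p"
          "b \<in> {0..n - 1}" "s \<otimes> q = add_pow R b q"
        using corner s by meson
      have "s = s \<otimes> (p \<oplus> q)" using s one by simp
      also have "\<dots> = k (a, b)" unfolding k_def using s c ab by (simp add: r_distr)
      finally show ?thesis using ab unfolding carB by blast
    qed
    ultimately show "bij_betw k (carrier ?B) (carrier R)"
      unfolding bij_betw_def using kc by blast
    show "\<one>\<^bsub>?B\<^esub> \<in> carrier ?B" unfolding carB using n(1)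
      by (simp add: RDirProd_def DirProd_def monoid.defs residue_ring_def)
    show "k \<one>\<^bsub>?B\<^esub> = \<one>" unfolding k_def using c one
      by (simp add: RDirProd_def DirProd_def monoid.defs residue_ring_def)
    fix u v assume "u \<in> carrier ?B" "v \<in> carrier ?B"
    obtain a b where u: "u = (a, b)" by (cases u)
    obtain a' b' where v: "v = (a', b')" by (cases v)
    have m: "u \<otimes>\<^bsub>?B\<^esub> v = ((a * a') mod n, (b * b') mod n)"
      "u \<oplus>\<^bsub>?B\<^esub> v = ((a + a') mod n, (b + b') mod n)"
      unfolding u v by (simp_all add: RDirProd_def DirProd_def monoid.defs residue_ring_def)
    show "u \<otimes>\<^bsub>?B\<^esub> v \<in> carrier ?B \<and> u \<oplus>\<^bsub>?B\<^esub> v \<in> carrier ?B"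
      unfolding m carB using n(1) by simp
    show "k (u \<oplus>\<^bsub>?B\<^esub> v) = k u \<oplus> k v"
      unfolding m unfolding u v k_def using c by (simp add: md add.int_pow_mult a_ac)
    show "k (u \<otimes>\<^bsub>?B\<^esub> v) = k u \<otimes> k v"
      unfolding m unfolding u v k_def using c by (simp add: md l_distr r_distr prod tab)
  qed
qed

theorem regular_GSWNC_cases:
  assumes G: "GSWNC R"
    and reg: "\<And>a. a \<in> carrier R \<Longrightarrow> \<exists>y \<in> carrier R. a \<otimes> y \<otimes> a = a"
  shows "swnc_ring R \<or> (\<one> \<noteq> \<zero> \<and> Units R = carrier R - {\<zero>})
    \<or> R \<simeq> M2 (residue_ring 2) \<or> R \<simeq> M2 (residue_ring 3)
    \<or> R \<simeq> RDirProd (residue_ring 3) (residue_ring 3)"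
proof (cases "\<forall>a \<in> carrier R. a \<otimes> a = \<zero> \<longrightarrow> a = \<zero>")
  case True
  then interpret reduced_ring R by unfold_locales blast
  from G show ?thesis
  proof (cases rule: GSWNC_cases)
    case (3 p q)
    have n0: "p \<noteq> \<zero>" "q \<noteq> \<zero>" using 3 by auto
    have sp: "s \<otimes> p \<in> {\<zero>, p, \<ominus> p}" if "s \<in> carrier R" for s
      using corner_signs[OF G 3(1,2,8) 3(3,4,9) 3(6) that] .
    have sq: "s \<otimes> q \<in> {\<zero>, q, \<ominus> q}" if "s \<in> carrier R" for s
      using corner_signs[OF G 3(3,4,9) 3(1,2,8) 3(7) that] .
    have "p \<oplus> p \<in> {\<zero>, p, \<ominus> p}" "q \<oplus> q \<in> {\<zero>, q, \<ominus> q}"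
      using sp[of "p \<oplus> p"] sq[of "q \<oplus> q"] 3 by (simp_all add: l_distr)
    \<comment> \<open>Neither \<open>2p\<close> nor \<open>2q\<close> is zero, so the order 3 is
      selected for both idempotents.\<close>
    then have mult: "add_pow R (3::int) p = \<zero>" "add_pow R (3::int) q = \<zero>"
      "\<And>i. i \<in> {0..3 - 1} \<Longrightarrow> add_pow R (i::int) p = \<zero> \<Longrightarrow> i = 0"
      "\<And>i. i \<in> {0..3 - 1} \<Longrightarrow> add_pow R (i::int) q = \<zero> \<Longrightarrow> i = 0"
      "\<And>d. d \<in> {\<zero>, p, \<ominus> p} \<Longrightarrow> \<exists>i \<in> {0..3 - 1 :: int}. d = add_pow R i p"
      "\<And>d. d \<in> {\<zero>, q, \<ominus> q} \<Longrightarrow> \<exists>i \<in> {0..3 - 1 :: int}. d = add_pow R i q"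
      using sign_multiples[OF 3(1) n0(1)] sign_multiples[OF 3(3) n0(2)] 3(8,9)
      by blast+
    have "add_pow R (3::int) \<one> = add_pow R (3::int) p \<oplus> add_pow R (3::int) q"
      unfolding 3(5)[symmetric] using 3(1,3) by (simp add: add_pow_three a_ac)
    then have "add_pow R (3::int) \<one> = \<zero>" using mult(1,2) by simp
    then have "R \<simeq> RDirProd (residue_ring 3) (residue_ring 3)"
      by (intro iso_RDirProd_residue_ring[OF 3(1,3,2,4,6,7,5) _ _ mult(3,4) mult(5)[OF sp] mult(6)[OF sq]])
        simp_all
    then show ?thesis by blast
  qed auto
next
  case False
  then obtain x where x: "x \<in> carrier R" "x \<noteq> \<zero>" "x \<otimes> x = \<zero>" by blast
  obtain y where y: "y \<in> carrier R" "y \<otimes> y = \<zero>" and xyx: "x \<otimes> y \<otimes> x = x" and yxy: "y \<otimes> x \<otimes> y = y"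
    using exists_matrix_units[OF reg one_closed l_one[OF one_closed] x(1) l_one[OF x(1)] r_one[OF x(1)] x(3)]
    by blast
  define e where "e = x \<otimes> y"
  define f where "f = y \<otimes> x"
  have c: "e \<in> carrier R" "x \<in> carrier R" "y \<in> carrier R" "f \<in> carrier R"
    unfolding e_def f_def using x y by auto
  have l0: "u \<otimes> (v \<otimes> w) = \<zero>" if "u \<otimes> v = \<zero>" "u \<in> carrier R" "v \<in> carrier R" "w \<in> carrier R" for u v w
    using that by (simp flip: m_assoc)
  have tab: "e \<otimes> e = e" "e \<otimes> x = x" "e \<otimes> y = \<zero>" "e \<otimes> f = \<zero>"
      "x \<otimes> e = \<zero>" "x \<otimes> x = \<zero>" "x \<otimes> y = e" "x \<otimes> f = x"
      "y \<otimes> e = y" "y \<otimes> x = f" "y \<otimes> y = \<zero>" "y \<otimes> f = \<zero>"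
      "f \<otimes> e = \<zero>" "f \<otimes> x = \<zero>" "f \<otimes> y = y" "f \<otimes> f = f"
    using x y xyx yxy l0 unfolding e_def f_def by (simp_all add: m_assoc)
  have one: "e \<oplus> f = \<one>" using matrix_units_sum[OF G x y xyx yxy] unfolding e_def f_def .
  have e0: "e \<noteq> \<zero>" using tab(2) x by auto
  have corner: "d \<in> {\<zero>, e, \<ominus> e}" if "d \<in> carrier R" "e \<otimes> d = d" "d \<otimes> e = d" for d
    using matrix_units_corner[OF G reg x y xyx yxy] that unfolding e_def by blast
  have "e \<oplus> e \<in> {\<zero>, e, \<ominus> e}" using c tab by (intro corner) (simp_all add: l_distr r_distr)
  then obtain n :: int where n: "n \<in> {2, 3}" "add_pow R n e = \<zero>"
    "\<And>i. i \<in> {0..n - 1} \<Longrightarrow> add_pow R i e = \<zero> \<Longrightarrow> i = 0"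
    "\<And>d. d \<in> {\<zero>, e, \<ominus> e} \<Longrightarrow> \<exists>i \<in> {0..n - 1}. d = add_pow R i e"
    using sign_multiples[OF c(1) e0] by blast
  \<comment> \<open>Since \<open>f = y e x\<close>, the order of \<open>e\<close> also kills
    \<open>f\<close>, hence 1.\<close>
  have "add_pow R n f = y \<otimes> add_pow R n e \<otimes> x"
    using c by (simp add: add_pow_ldistr_int add_pow_rdistr_int tab)
  then have "add_pow R n f = \<zero>" using n(2) c by simp
  moreover have "add_pow R n \<one> = add_pow R n e \<oplus> add_pow R n f"
    unfolding one[symmetric] using c by (simp add: add.int_pow_distrib)
  ultimately have n1: "add_pow R n \<one> = \<zero>" using n(2) by simp
  have "R \<simeq> M2 (residue_ring n)"
  proof (rule iso_M2_residue_ring[OF c tab one _ n1 n(3)])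
    show "1 < n" using n(1) by auto
    fix s assume s: "s \<in> carrier R"
    have "e \<otimes> (e \<otimes> s \<otimes> e) = (e \<otimes> e) \<otimes> s \<otimes> e" "e \<otimes> s \<otimes> e \<otimes> e = e \<otimes> s \<otimes> (e \<otimes> e)"
      using s c by (simp_all add: m_assoc)
    then show "\<exists>i \<in> {0..n - 1}. e \<otimes> s \<otimes> e = add_pow R i e"
      using s c tab(1) by (intro n(4) corner) simp_all
  qed
  then show ?thesis using n(1) by auto
qed

end

section \<open>Passing to the quotient by the Jacobson radical\<close>

lemma (in ring_hom_ring) hom_nilpotent:
  assumes "nilpotent_el R q"
  shows "nilpotent_el S (h q)"
proof -
  obtain n :: nat where q: "q \<in> carrier R" "q [^] n = \<zero>"
    using assms unfolding nilpotent_el_def by blast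
  have "h (q [^] n) = h q [^]\<^bsub>S\<^esub> n" using q(1) by (induction n) auto
  then show ?thesis using q unfolding nilpotent_el_def by (metis hom_closed hom_zero)
qed

lemma (in ring_hom_ring) hom_Units:
  assumes "r \<in> Units R"
  shows "h r \<in> Units S"
proof -
  have r: "r \<in> carrier R" "inv r \<in> carrier R" using assms by auto
  have "h (inv r) \<otimes>\<^bsub>S\<^esub> h r = \<one>\<^bsub>S\<^esub>" "h r \<otimes>\<^bsub>S\<^esub> h (inv r) = \<one>\<^bsub>S\<^esub>"
    using r assms by (simp_all flip: hom_mult)
  then show ?thesis 
    unfolding Units_def using hom_closed[OF r(1)] hom_closed[OF r(2)] by blast
qed

context ring
begin

abbreviation jacobson_proj (\<open>\<pi>\<close>) where "\<pi> \<equiv> a_r_coset R (jacobson R)"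

lemma jacobson_proj_hom: "ring_hom_ring R (R Quot jacobson R) \<pi>"
  using ideal.rcos_ring_hom_ring[OF ideal_jacobson] .

lemma jacobson_proj_surj:
  assumes "u \<in> carrier (R Quot jacobson R)"
  obtains r where "r \<in> carrier R" "u = \<pi> r"
  using assms unfolding FactRing_def A_RCOSETS_def' by auto

lemma jacobson_proj_zero_iff:
  assumes r: "r \<in> carrier R"
  shows "\<pi> r = \<zero>\<^bsub>R Quot jacobson R\<^esub> \<longleftrightarrow> r \<in> jacobson R"
proof -
  interpret ideal "jacobson R" R by (rule ideal_jacobson)
  have "\<zero>\<^bsub>R Quot jacobson R\<^esub> = jacobson R" by (simp add: FactRing_def)
  then show ?thesis using a_rcos_const a_rcos_self[OF r] by metis
qed

text \<open>Anything congruent to 1 modulo the radical is a unit. If \<open>s\<close> lifts the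
  inverse of the image of \<open>r\<close>, then \<open>r s\<close> and \<open>s r\<close> are
  units, and so is \<open>r\<close>.\<close>

lemma jacobson_proj_Units_iff:
  assumes r: "r \<in> carrier R"
  shows "\<pi> r \<in> Units (R Quot jacobson R) \<longleftrightarrow> r \<in> Units R"
proof -
  interpret \<pi>: ring_hom_ring R "R Quot jacobson R" \<pi> by (rule jacobson_proj_hom)
  have lift: "c \<in> Units R" if c: "c \<in> carrier R" "\<pi> c = \<one>\<^bsub>R Quot jacobson R\<^esub>" for c
  proof -
    have "\<pi> (c \<ominus> \<one>) = \<zero>\<^bsub>R Quot jacobson R\<^esub>" using c by (simp add: minus_eq \<pi>.S.r_neg)
    then have "c \<ominus> \<one> \<in> jacobson R" using jacobson_proj_zero_iff c by simp
    then have "\<one> \<oplus> (c \<ominus> \<one>) \<in> Units R" by (rule one_add_jacobson_Units)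
    moreover have "\<one> \<oplus> (c \<ominus> \<one>) = c" using c(1) by algebra
    ultimately show ?thesis by simp
  qed
  have "r \<in> Units R" if pr: "\<pi> r \<in> Units (R Quot jacobson R)"
  proof -
    obtain u where u: "u \<in> carrier (R Quot jacobson R)"
      "u \<otimes>\<^bsub>R Quot jacobson R\<^esub> \<pi> r = \<one>\<^bsub>R Quot jacobson R\<^esub>"
      "\<pi> r \<otimes>\<^bsub>R Quot jacobson R\<^esub> u = \<one>\<^bsub>R Quot jacobson R\<^esub>"
      using pr unfolding Units_def by blast
    obtain s where s: "s \<in> carrier R" "u = \<pi> s" using jacobson_proj_surj[OF u(1)] .
    have "r \<otimes> s \<in> Units R" "s \<otimes> r \<in> Units R"
      using r s u by (auto intro!: lift)
    then show ?thesis using Units_of_mult_Units r s(1) by blast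
  qed
  then show ?thesis using \<pi>.hom_Units by blast
qed

section \<open>Transfer of the nil-clean conditions along the projection\<close>

lemma jacobson_proj_swnc_el:
  assumes r: "r \<in> carrier R" and el: "swnc_el R r"
  shows "swnc_el (R Quot jacobson R) (\<pi> r)"
proof -
  interpret \<pi>: ring_hom_ring R "R Quot jacobson R" \<pi> by (rule jacobson_proj_hom)
  have "\<pi> (r \<otimes> r \<ominus> r) = \<pi> r \<otimes>\<^bsub>R Quot jacobson R\<^esub> \<pi> r \<ominus>\<^bsub>R Quot jacobson R\<^esub> \<pi> r"
    "\<pi> (r \<otimes> r \<oplus> r) = \<pi> r \<otimes>\<^bsub>R Quot jacobson R\<^esub> \<pi> r \<oplus>\<^bsub>R Quot jacobson R\<^esub> \<pi> r"
    using r by (simp_all add: minus_eq \<pi>.S.minus_eq)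
  then show ?thesis
    using el \<pi>.hom_nilpotent unfolding swnc_el_iff[OF r] \<pi>.S.swnc_el_iff[OF \<pi>.hom_closed[OF r]] by metis
qed

lemma nil_jacobson_swnc_el_lift:
  assumes nil: "nil_set R (jacobson R)" and r: "r \<in> carrier R"
    and el: "swnc_el (R Quot jacobson R) (\<pi> r)"
  shows "swnc_el R r"
proof -
  interpret \<pi>: ring_hom_ring R "R Quot jacobson R" \<pi> by (rule jacobson_proj_hom)
  have lift: "nilpotent_el R c" if c: "c \<in> carrier R" "nilpotent_el (R Quot jacobson R) (\<pi> c)" for c
  proof -
    obtain n :: nat where n: "\<pi> c [^]\<^bsub>R Quot jacobson R\<^esub> n = \<zero>\<^bsub>R Quot jacobson R\<^esub>"
      using c(2) unfolding nilpotent_el_def by blast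
    have "\<pi> (c [^] n) = \<pi> c [^]\<^bsub>R Quot jacobson R\<^esub> n" using c(1) by (induction n) auto
    then have "c [^] n \<in> jacobson R" using n jacobson_proj_zero_iff[of "c [^] n"] c(1) by simp
    then obtain m :: nat where "(c [^] n) [^] m = \<zero>"
      using nil unfolding nil_set_def nilpotent_el_def by blast
    then have "c [^] (n * m) = \<zero>" using c(1) by (simp add: nat_pow_pow)
    then show ?thesis using c(1) unfolding nilpotent_el_def by blast
  qed
  have "\<pi> (r \<otimes> r \<ominus> r) = \<pi> r \<otimes>\<^bsub>R Quot jacobson R\<^esub> \<pi> r \<ominus>\<^bsub>R Quot jacobson R\<^esub> \<pi> r"
    "\<pi> (r \<otimes> r \<oplus> r) = \<pi> r \<otimes>\<^bsub>R Quot jacobson R\<^esub> \<pi> r \<oplus>\<^bsub>R Quot jacobson R\<^esub> \<pi> r"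
    using r by (simp_all add: minus_eq \<pi>.S.minus_eq)
  then show ?thesis
    using el lift r unfolding swnc_el_iff[OF r] \<pi>.S.swnc_el_iff[OF \<pi>.hom_closed[OF r]]
    by (metis a_closed m_closed minus_closed)
qed

lemma GSWNC_Quot_jacobson:
  assumes "GSWNC R"
  shows "GSWNC (R Quot jacobson R)"
  unfolding GSWNC_def
proof (intro ballI impI)
  fix u assume u: "u \<in> carrier (R Quot jacobson R)" "u \<notin> Units (R Quot jacobson R)"
  then obtain r where "r \<in> carrier R" "u = \<pi> r" using jacobson_proj_surj by blast
  then show "swnc_el (R Quot jacobson R) u"
    using assms u(2) jacobson_proj_Units_iff jacobson_proj_swnc_el unfolding GSWNC_def by blast
qed

lemma nil_jacobson_GSWNC_lift:
  assumes "nil_set R (jacobson R)" "GSWNC (R Quot jacobson R)"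
  shows "GSWNC R"
  unfolding GSWNC_def
proof (intro ballI impI)
  interpret \<pi>: ring_hom_ring R "R Quot jacobson R" \<pi> by (rule jacobson_proj_hom)
  fix r assume r: "r \<in> carrier R" "r \<notin> Units R"
  then have "swnc_el (R Quot jacobson R) (\<pi> r)"
    using assms(2) jacobson_proj_Units_iff \<pi>.hom_closed unfolding GSWNC_def by blast
  then show "swnc_el R r" using nil_jacobson_swnc_el_lift assms(1) r(1) by blast
qed

lemma nil_jacobson_swnc_ring_lift:
  assumes "nil_set R (jacobson R)" "swnc_ring (R Quot jacobson R)"
  shows "swnc_ring R"
proof -
  interpret \<pi>: ring_hom_ring R "R Quot jacobson R" \<pi> by (rule jacobson_proj_hom)
  show ?thesis
    using nil_jacobson_swnc_el_lift assms \<pi>.hom_closed unfolding swnc_ring_def by blast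
qed

text \<open>For \<open>j\<close> in the radical, \<open>j^2 - j = -j(1 - j)\<close> and
  \<open>j^2 + j = j(1 + j)\<close>, where \<open>1 - j\<close> and \<open>1 + j\<close> are units
  commuting with \<open>j\<close>. Cancelling the unit leaves \<open>j\<close> nilpotent.\<close>

lemma GSWNC_nil_jacobson:
  assumes G: "GSWNC R"
  shows "nil_set R (jacobson R)"
  unfolding nil_set_def
proof
  fix j assume j: "j \<in> jacobson R"
  have jc: "j \<in> carrier R" using j jacobson_iff by blast
  have mj: "\<ominus> j \<in> jacobson R" using left_ideal_uminus[OF left_ideal_jacobson j] .
  have cancel: "nilpotent_el R j" if u: "u \<in> Units R" "j \<otimes> u = u \<otimes> j" "nilpotent_el R (j \<otimes> u)" for u
  proof -
    have uc: "u \<in> carrier R" "inv u \<in> carrier R" using u(1) by auto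
    have "(j \<otimes> u) \<otimes> inv u = j" using u(1) uc jc by (simp add: m_assoc)
    moreover have "inv u \<otimes> (j \<otimes> u) = (inv u \<otimes> u) \<otimes> j"
      unfolding u(2) using uc jc by (simp add: m_assoc)
    then have "inv u \<otimes> (j \<otimes> u) = j" using u(1) jc by simp
    ultimately show ?thesis using nilpotent_mult_commute[OF u(3) uc(2)] by simp
  qed
  show "nilpotent_el R j"
  proof (cases "j \<in> Units R")
    \<comment> \<open>The radical contains a unit only in the zero ring, where it is the whole
      carrier.\<close>
    case True
    then have "inv j \<otimes> j \<in> jacobson R"
      using left_ideal_mult[OF left_ideal_jacobson Units_inv_closed j] by blast
    then have "\<ominus> \<one> \<in> jacobson R" using True left_ideal_uminus[OF left_ideal_jacobson] by simp
    then have "\<one> \<oplus> \<ominus> \<one> \<in> Units R" by (rule one_add_jacobson_Units)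
    then have "\<one> = \<zero>" using not_Units_if_annihilated[of \<zero> \<one>] by (auto simp: r_neg)
    then have "j = \<zero>" using one_zeroD jc by blast
    then show ?thesis using nilpotent_el_zero by simp
  next
    case False
    then have "nilpotent_el R (j \<otimes> j \<ominus> j) \<or> nilpotent_el R (j \<otimes> j \<oplus> j)"
      using GSWNC_nonunit[OF G jc] by blast
    then show ?thesis
    proof
      assume n: "nilpotent_el R (j \<otimes> j \<ominus> j)"
      have "j \<otimes> (\<one> \<oplus> \<ominus> j) = \<ominus> (j \<otimes> j \<ominus> j)"
        using jc by (simp add: minus_eq r_distr r_minus minus_add a_comm)
      then have "nilpotent_el R (j \<otimes> (\<one> \<oplus> \<ominus> j))" using nilpotent_minus[OF n] by simp
      moreover have "j \<otimes> (\<one> \<oplus> \<ominus> j) = (\<one> \<oplus> \<ominus> j) \<otimes> j"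
        using jc by (simp add: l_distr r_distr l_minus r_minus)
      ultimately show ?thesis using cancel one_add_jacobson_Units[OF mj] by blast
    next
      assume n: "nilpotent_el R (j \<otimes> j \<oplus> j)"
      have "j \<otimes> (\<one> \<oplus> j) = j \<otimes> j \<oplus> j" "j \<otimes> (\<one> \<oplus> j) = (\<one> \<oplus> j) \<otimes> j"
        using jc by (simp_all add: l_distr r_distr a_comm)
      then show ?thesis using n cancel one_add_jacobson_Units[OF j] by metis
    qed
  qed
qed

text \<open>The radical is the unique maximal left ideal, so everything outside it is left
  invertible. A left inverse \<open>b\<close> of \<open>a\<close> is itself outside, since otherwise
  \<open>b a = 1\<close> would be in the radical; its own left inverse must then be
  \<open>a\<close>.\<close>

lemma local_ring_nonunit_in_jacobson:
  assumes L: "local_ring R" and a: "a \<in> carrier R" "a \<notin> Units R"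
  shows "a \<in> jacobson R"
proof (rule ccontr)
  assume na: "a \<notin> jacobson R"
  obtain M where M: "maximal_left_ideal R M" "\<And>I. maximal_left_ideal R I \<Longrightarrow> I = M"
    using L unfolding local_ring_def by blast
  have inv: "\<exists>v \<in> carrier R. v \<otimes> c = \<one>" if c: "c \<in> carrier R" "c \<notin> jacobson R" for c
  proof (rule ccontr)
    assume "\<not> ?thesis"
    then have "\<one> \<notin> (\<lambda>r. r \<otimes> c) ` carrier R" by auto
    then obtain I where I: "maximal_left_ideal R I" "(\<lambda>r. r \<otimes> c) ` carrier R \<subseteq> I"
      using exists_maximal_left_ideal[OF left_ideal_principal[OF c(1)]] by blast
    have "\<one> \<otimes> c \<in> M" using I M(2) by blast
    then show False using c M(2) unfolding jacobson_iff by auto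
  qed
  obtain b where b: "b \<in> carrier R" "b \<otimes> a = \<one>" using inv[OF a(1) na] by blast
  have "b \<notin> jacobson R"
  proof
    assume "b \<in> jacobson R"
    then have "\<one> \<in> jacobson R" using jacobson_mult_right[OF _ a(1)] b(2) by metis
    then show False
      using M(1) left_ideal_eq_carrier unfolding jacobson_iff maximal_left_ideal_def by blast
  qed
  then obtain v where v: "v \<in> carrier R" "v \<otimes> b = \<one>" using inv[OF b(1)] by blast
  have "v = v \<otimes> (b \<otimes> a)" using v b by simp
  also have "\<dots> = (v \<otimes> b) \<otimes> a" using v(1) b(1) a(1) by (simp add: m_assoc)
  also have "\<dots> = a" using v(2) a(1) by simp
  finally show False using a v b unfolding Units_def by blast
qed

lemma nilpotent_swnc_el:
  assumes "nilpotent_el R a"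
  shows "swnc_el R a"
proof -
  have a: "a \<in> carrier R" using assms unfolding nilpotent_el_def by blast
  have "nilpotent_el R (a \<otimes> (a \<ominus> \<one>))"
    using assms a by (intro nilpotent_mult_commute) (auto simp: minus_eq l_distr r_distr l_minus r_minus)
  moreover have "a \<otimes> (a \<ominus> \<one>) = a \<otimes> a \<ominus> a" using a by (simp add: minus_eq r_distr r_minus)
  ultimately show ?thesis using swnc_el_iff a by simp
qed

lemma local_ring_nil_jacobson_GSWNC:
  assumes "local_ring R" "nil_set R (jacobson R)"
  shows "GSWNC R"
  using assms local_ring_nonunit_in_jacobson nilpotent_swnc_el
  unfolding GSWNC_def nil_set_def by blast

text \<open>A left ideal strictly above the radical contains a unit, so the radical is a maximal
  left ideal. Every maximal left ideal contains it and therefore equals it.\<close>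

lemma local_ring_if_Quot_jacobson_division:
  assumes one: "\<one>\<^bsub>R Quot jacobson R\<^esub> \<noteq> \<zero>\<^bsub>R Quot jacobson R\<^esub>"
    and U: "Units (R Quot jacobson R) = carrier (R Quot jacobson R) - {\<zero>\<^bsub>R Quot jacobson R\<^esub>}"
  shows "local_ring R"
proof -
  interpret \<pi>: ring_hom_ring R "R Quot jacobson R" \<pi> by (rule jacobson_proj_hom)
  have "\<one> \<notin> jacobson R" using one jacobson_proj_zero_iff[OF one_closed] by simp
  moreover have "K = jacobson R \<or> K = carrier R" if K: "left_ideal R K" "jacobson R \<subseteq> K" for K
  proof (rule disjCI)
    assume no: "K \<noteq> carrier R"
    have "k \<in> jacobson R" if k: "k \<in> K" for k
    proof (rule ccontr)
      assume nk: "k \<notin> jacobson R"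
      have kc: "k \<in> carrier R" using left_ideal_carrier[OF K(1) k] .
      have "\<pi> k \<in> Units (R Quot jacobson R)"
        unfolding U using nk jacobson_proj_zero_iff[OF kc] \<pi>.hom_closed[OF kc] by simp
      then have "k \<in> Units R" using jacobson_proj_Units_iff[OF kc] by simp
      then have "\<one> \<in> K" using left_ideal_mult[OF K(1) _ k, of "inv k"] by simp
      then show False using left_ideal_eq_carrier[OF K(1)] no by blast
    qed
    then show "K = jacobson R" using K(2) by blast
  qed
  ultimately have M: "maximal_left_ideal R (jacobson R)"
    using left_ideal_jacobson unfolding maximal_left_ideal_def by auto
  have "I = jacobson R" if I: "maximal_left_ideal R I" for I
  proof -
    have "jacobson R \<subseteq> I" using I jacobson_iff by blast
    then show ?thesis using I M unfolding maximal_left_ideal_def by blast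
  qed
  then show ?thesis unfolding local_ring_def using M by blast
qed

text \<open>Adding \<open>1\<close> on both sides of \<open>u\<^sup>2 + u = 0\<close> avoids having to know that \<open>B\<close> is a ring, with zero
  preserved by the isomorphism.\<close>

lemma GSWNC_via_iso:
  assumes iso: "R \<simeq> B" and one: "\<one>\<^bsub>B\<^esub> \<in> carrier B"
    and B: "\<And>u. u \<in> carrier B \<Longrightarrow>
      (\<exists>v \<in> carrier B. u \<otimes>\<^bsub>B\<^esub> v = \<one>\<^bsub>B\<^esub> \<and> v \<otimes>\<^bsub>B\<^esub> u = \<one>\<^bsub>B\<^esub>)
      \<or> u \<otimes>\<^bsub>B\<^esub> u = u \<or> u \<otimes>\<^bsub>B\<^esub> u \<oplus>\<^bsub>B\<^esub> \<one>\<^bsub>B\<^esub> = \<one>\<^bsub>B\<^esub> \<or> (u \<otimes>\<^bsub>B\<^esub> u \<oplus>\<^bsub>B\<^esub> u) \<oplus>\<^bsub>B\<^esub> \<one>\<^bsub>B\<^esub> = \<one>\<^bsub>B\<^esub>"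
  shows "GSWNC R"
  unfolding GSWNC_def
proof (intro ballI impI)
  obtain h where h: "h \<in> ring_iso R B" using iso unfolding is_ring_iso_def by blast
  note hm = ring_iso_memE[OF h]
  have inj: "x = y" if "h x = h y" "x \<in> carrier R" "y \<in> carrier R" for x y
    using that hm(5) unfolding bij_betw_def inj_on_def by blast
  fix a assume a: "a \<in> carrier R" "a \<notin> Units R"
  have "\<not> (\<exists>v \<in> carrier B. h a \<otimes>\<^bsub>B\<^esub> v = \<one>\<^bsub>B\<^esub> \<and> v \<otimes>\<^bsub>B\<^esub> h a = \<one>\<^bsub>B\<^esub>)"
  proof
    assume "\<exists>v \<in> carrier B. h a \<otimes>\<^bsub>B\<^esub> v = \<one>\<^bsub>B\<^esub> \<and> v \<otimes>\<^bsub>B\<^esub> h a = \<one>\<^bsub>B\<^esub>"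
    then obtain v where v: "v \<in> carrier B" "h a \<otimes>\<^bsub>B\<^esub> v = \<one>\<^bsub>B\<^esub>" "v \<otimes>\<^bsub>B\<^esub> h a = \<one>\<^bsub>B\<^esub>" by blast
    obtain b where b: "b \<in> carrier R" "v = h b" using v(1) hm(5) unfolding bij_betw_def by blast
    have "h (a \<otimes> b) = h \<one>" "h (b \<otimes> a) = h \<one>" using a b v hm by simp_all
    then have "a \<otimes> b = \<one>" "b \<otimes> a = \<one>" using inj a(1) b(1) by simp_all
    then show False using a b unfolding Units_def by blast
  qed
  then have "h a \<otimes>\<^bsub>B\<^esub> h a = h a \<or> h a \<otimes>\<^bsub>B\<^esub> h a \<oplus>\<^bsub>B\<^esub> \<one>\<^bsub>B\<^esub> = \<one>\<^bsub>B\<^esub>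
      \<or> (h a \<otimes>\<^bsub>B\<^esub> h a \<oplus>\<^bsub>B\<^esub> h a) \<oplus>\<^bsub>B\<^esub> \<one>\<^bsub>B\<^esub> = \<one>\<^bsub>B\<^esub>"
    using B hm(1) a(1) by blast
  then have "h (a \<otimes> a) = h a \<or> h (a \<otimes> a \<oplus> \<one>) = h \<one> \<or> h ((a \<otimes> a \<oplus> a) \<oplus> \<one>) = h \<one>"
    using a(1) hm by simp
  then have "a \<otimes> a = a \<or> a \<otimes> a \<oplus> \<one> = \<one> \<or> (a \<otimes> a \<oplus> a) \<oplus> \<one> = \<one>" using inj a(1) by blast
  moreover have "z = \<zero>" if "z \<oplus> \<one> = \<one>" "z \<in> carrier R" for z
    using that add.r_cancel_one'[of \<one> z] by auto
  ultimately consider "a \<otimes> a = a" | "a \<otimes> a = \<zero>" | "a \<otimes> a \<oplus> a = \<zero>" using a(1) by blast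
  then show "swnc_el R a"
  proof cases
    case 2
    then have "nilpotent_el R a"
      unfolding nilpotent_el_def using a(1) by (auto intro!: exI[of _ "2::nat"] simp: numeral_2_eq_2)
    then show ?thesis by (rule nilpotent_swnc_el)
  qed (use swnc_el_if_square minus_eq_zero_iff(2) a(1) in simp_all)
qed

text \<open>Over the fields with 2 and 3 elements a singular matrix satisfies
  \<open>u^2 = tr(u) u\<close> by Cayley-Hamilton, and the trace is 0, 1 or -1. This accounts for
  the three alternatives besides invertibility, which are checked by enumeration.\<close>

lemma GSWNC_if_iso_M2:
  assumes iso: "R \<simeq> M2 (residue_ring n)" and n: "n = 2 \<or> n = 3"
  shows "GSWNC R"
proof (rule GSWNC_via_iso[OF iso])
  let ?B = "M2 (residue_ring n)"
  show "\<one>\<^bsub>?B\<^esub> \<in> carrier ?B" using n by (auto simp: M2_def residue_ring_def)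
  fix u assume u: "u \<in> carrier ?B"
  obtain a b c d where abcd: "u = (a, b, c, d)" by (cases u)
  define t where "t = a * d - b * c"
  \<comment> \<open>The adjugate times the determinant \<open>t\<close>: a nonzero \<open>t\<close>
    is 1 or -1 modulo 2 or 3, hence its own inverse.\<close>
  define v where "v = (t * d mod n, - t * b mod n, - t * c mod n, t * a mod n)"
  have "v \<in> carrier ?B" using n unfolding v_def by (auto simp: M2_def residue_ring_def)
  moreover have "(u \<otimes>\<^bsub>?B\<^esub> v = \<one>\<^bsub>?B\<^esub> \<and> v \<otimes>\<^bsub>?B\<^esub> u = \<one>\<^bsub>?B\<^esub>)
      \<or> u \<otimes>\<^bsub>?B\<^esub> u = u \<or> u \<otimes>\<^bsub>?B\<^esub> u \<oplus>\<^bsub>?B\<^esub> \<one>\<^bsub>?B\<^esub> = \<one>\<^bsub>?B\<^esub> \<or> (u \<otimes>\<^bsub>?B\<^esub> u \<oplus>\<^bsub>?B\<^esub> u) \<oplus>\<^bsub>?B\<^esub> \<one>\<^bsub>?B\<^esub> = \<one>\<^bsub>?B\<^esub>"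
    using n
  proof
    assume n: "n = 2"
    have "a \<in> {0, 1}" "b \<in> {0, 1}" "c \<in> {0, 1}" "d \<in> {0, 1}"
      using u unfolding abcd n by (auto simp: M2_def residue_ring_def)
    then show ?thesis
      unfolding insert_iff empty_iff simp_thms
      unfolding v_def t_def abcd n M2_def m2_mult_def m2_add_def residue_ring_def
      by (elim disjE; simp only: monoid.simps ring.simps partial_object.simps prod.case; simp)
  next
    assume n: "n = 3"
    have "a \<in> {0, 1, 2}" "b \<in> {0, 1, 2}" "c \<in> {0, 1, 2}" "d \<in> {0, 1, 2}"
      using u unfolding abcd n by (auto simp: M2_def residue_ring_def)
    then show ?thesis
      unfolding insert_iff empty_iff simp_thms
      unfolding v_def t_def abcd n M2_def m2_mult_def m2_add_def residue_ring_def
      by (elim disjE; simp only: monoid.simps ring.simps partial_object.simps prod.case; simp)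
  qed
  ultimately show "(\<exists>v \<in> carrier ?B. u \<otimes>\<^bsub>?B\<^esub> v = \<one>\<^bsub>?B\<^esub> \<and> v \<otimes>\<^bsub>?B\<^esub> u = \<one>\<^bsub>?B\<^esub>)
      \<or> u \<otimes>\<^bsub>?B\<^esub> u = u \<or> u \<otimes>\<^bsub>?B\<^esub> u \<oplus>\<^bsub>?B\<^esub> \<one>\<^bsub>?B\<^esub> = \<one>\<^bsub>?B\<^esub> \<or> (u \<otimes>\<^bsub>?B\<^esub> u \<oplus>\<^bsub>?B\<^esub> u) \<oplus>\<^bsub>?B\<^esub> \<one>\<^bsub>?B\<^esub> = \<one>\<^bsub>?B\<^esub>"
    by blast
qed

text \<open>If both coordinates are nonzero, the element squares to 1 and is its own inverse. If one
  is zero, the other is 0, 1 or -1, so the square is the element or its negative.\<close>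

lemma GSWNC_if_iso_RDirProd:
  assumes iso: "R \<simeq> RDirProd (residue_ring 3) (residue_ring 3)"
  shows "GSWNC R"
proof (rule GSWNC_via_iso[OF iso])
  let ?B = "RDirProd (residue_ring 3) (residue_ring 3)"
  note defs = RDirProd_def DirProd_def monoid.defs residue_ring_def
  show "\<one>\<^bsub>?B\<^esub> \<in> carrier ?B" by (simp add: defs)
  fix u assume u: "u \<in> carrier ?B"
  obtain a b where ab: "u = (a, b)" by (cases u)
  have "a \<in> {0, 1, 2}" "b \<in> {0, 1, 2}" using u unfolding ab by (auto simp: defs)
  then have "(u \<otimes>\<^bsub>?B\<^esub> u = \<one>\<^bsub>?B\<^esub> \<and> u \<otimes>\<^bsub>?B\<^esub> u = \<one>\<^bsub>?B\<^esub>)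
      \<or> u \<otimes>\<^bsub>?B\<^esub> u = u \<or> u \<otimes>\<^bsub>?B\<^esub> u \<oplus>\<^bsub>?B\<^esub> \<one>\<^bsub>?B\<^esub> = \<one>\<^bsub>?B\<^esub> \<or> (u \<otimes>\<^bsub>?B\<^esub> u \<oplus>\<^bsub>?B\<^esub> u) \<oplus>\<^bsub>?B\<^esub> \<one>\<^bsub>?B\<^esub> = \<one>\<^bsub>?B\<^esub>"
    unfolding insert_iff empty_iff simp_thms unfolding ab defs by (elim disjE) simp_all
  then show "(\<exists>v \<in> carrier ?B. u \<otimes>\<^bsub>?B\<^esub> v = \<one>\<^bsub>?B\<^esub> \<and> v \<otimes>\<^bsub>?B\<^esub> u = \<one>\<^bsub>?B\<^esub>)
      \<or> u \<otimes>\<^bsub>?B\<^esub> u = u \<or> u \<otimes>\<^bsub>?B\<^esub> u \<oplus>\<^bsub>?B\<^esub> \<one>\<^bsub>?B\<^esub> = \<one>\<^bsub>?B\<^esub> \<or> (u \<otimes>\<^bsub>?B\<^esub> u \<oplus>\<^bsub>?B\<^esub> u) \<oplus>\<^bsub>?B\<^esub> \<one>\<^bsub>?B\<^esub> = \<one>\<^bsub>?B\<^esub>"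
    using u by blast
qed

end

section \<open>The equivalence for semi-local rings\<close>

theorem theorem2p36:
  fixes R :: "('a, 'b) ring_scheme"
  assumes "ring R"
    and "semilocal R"
  shows "GSWNC R \<longleftrightarrow>
     ((local_ring R \<and> nil_set R (jacobson R))
      \<or> (nil_set R (jacobson R) \<and> R Quot (jacobson R) \<simeq> M2 (residue_ring 3))
      \<or> (nil_set R (jacobson R) \<and> R Quot (jacobson R) \<simeq> M2 (residue_ring 2))
      \<or> (nil_set R (jacobson R) \<and>
           R Quot (jacobson R) \<simeq> RDirProd (residue_ring 3) (residue_ring 3))
      \<or> swnc_ring R)"
proof
  interpret ring R by fact
  interpret S: ring "R Quot jacobson R" using ideal.quotient_is_ring[OF ideal_jacobson] .
  {
    assume G: "GSWNC R"
    have nil: "nil_set R (jacobson R)" using GSWNC_nil_jacobson[OF G] .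
    have "swnc_ring (R Quot jacobson R)
      \<or> (\<one>\<^bsub>R Quot jacobson R\<^esub> \<noteq> \<zero>\<^bsub>R Quot jacobson R\<^esub>
          \<and> Units (R Quot jacobson R) = carrier (R Quot jacobson R) - {\<zero>\<^bsub>R Quot jacobson R\<^esub>})
      \<or> R Quot jacobson R \<simeq> M2 (residue_ring 2) \<or> R Quot jacobson R \<simeq> M2 (residue_ring 3)
      \<or> R Quot jacobson R \<simeq> RDirProd (residue_ring 3) (residue_ring 3)"
      using S.regular_GSWNC_cases[OF GSWNC_Quot_jacobson[OF G]] S.semisimple_artinian_regular assms(2)
      unfolding semilocal_def by blast
    then show "(local_ring R \<and> nil_set R (jacobson R))
      \<or> (nil_set R (jacobson R) \<and> R Quot (jacobson R) \<simeq> M2 (residue_ring 3))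
      \<or> (nil_set R (jacobson R) \<and> R Quot (jacobson R) \<simeq> M2 (residue_ring 2))
      \<or> (nil_set R (jacobson R) \<and>
           R Quot (jacobson R) \<simeq> RDirProd (residue_ring 3) (residue_ring 3))
      \<or> swnc_ring R"
      \<comment> \<open>A division quotient means that \<open>R\<close> is local, and a strongly
        weakly nil-clean quotient lifts because the radical is nil.\<close>
      using nil local_ring_if_Quot_jacobson_division nil_jacobson_swnc_ring_lift by blast
  next
    assume "(local_ring R \<and> nil_set R (jacobson R))
      \<or> (nil_set R (jacobson R) \<and> R Quot (jacobson R) \<simeq> M2 (residue_ring 3))
      \<or> (nil_set R (jacobson R) \<and> R Quot (jacobson R) \<simeq> M2 (residue_ring 2))
      \<or> (nil_set R (jacobson R) \<and>
           R Quot (jacobson R) \<simeq> RDirProd (residue_ring 3) (residue_ring 3))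
      \<or> swnc_ring R"
    moreover have "GSWNC R" if "swnc_ring R" using that unfolding swnc_ring_def GSWNC_def by blast
    ultimately show "GSWNC R"
      using local_ring_nil_jacobson_GSWNC nil_jacobson_GSWNC_lift S.GSWNC_if_iso_M2
        S.GSWNC_if_iso_RDirProd by blast
  }
qed

end
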